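(* Let $p>5$ be a prime and $G=\mathrm{PSL}(2,p)$. Every witness to failure for $G$ has order $2$ or $3$. If moreover $p\not\equiv \pm 1 \pmod{10}$, every witness to failure for $G$ has order $2$.
   Context: For a finite group $G$, a sequence $s=(g_1,\dots,g_n)\in G^n$ is a generating sequence if $G=\langle g_1,\dots,g_n\rangle$; it is irredundant if no proper subsequence of $s$ generates $G$. Let $m(G)$ be the largest length of an irredundant generating sequence of $G$. A nontrivial element $g\in G$ is a witness to failure if there exists an irredundant generating sequence $s=(g_1,\dots,g_m)$ of $G$ of length $m=m(G)$ such that for no $i\in\{1,\dots,m\}$ does $(g_1,\dots,g_{i-1},g,g_{i+1},\dots,g_m)$ generate $G$. *)

theory Defs
  imports "HOL-Library.Sublist" "HOL-Computational_Algebra.Primes" "HOL-Algebra.Algebra"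
begin

text \<open>2x2 matrices (a,b,c,d) = [[a,b],[c,d]] with entries in {0..<p} (residues mod p),
  determinant congruent to 1 mod p, multiplication mod p.\<close>

definition mat_mult_mod :: "int \<Rightarrow> int \<times> int \<times> int \<times> int \<Rightarrow> int \<times> int \<times> int \<times> int \<Rightarrow> int \<times> int \<times> int \<times> int" where
  "mat_mult_mod p M N = (case M of (a, b, c, d) \<Rightarrow> case N of (e, f, g, h) \<Rightarrow>
     ((a * e + b * g) mod p, (a * f + b * h) mod p, (c * e + d * g) mod p, (c * f + d * h) mod p))"

definition SL2_carrier :: "int \<Rightarrow> (int \<times> int \<times> int \<times> int) set" where
  "SL2_carrier p = {(a, b, c, d). 0 \<le> a \<and> a < p \<and> 0 \<le> b \<and> b < p \<and> 0 \<le> c \<and> c < p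
                       \<and> 0 \<le> d \<and> d < p \<and> (a * d - b * c) mod p = 1}"

definition SL2 :: "int \<Rightarrow> (int \<times> int \<times> int \<times> int) monoid" where
  "SL2 p = \<lparr>carrier = SL2_carrier p, monoid.mult = mat_mult_mod p, one = (1, 0, 0, 1)\<rparr>"

definition PSL2 :: "int \<Rightarrow> (int \<times> int \<times> int \<times> int) set monoid" where
  "PSL2 p = SL2 p Mod {(1, 0, 0, 1), (p - 1, 0, 0, p - 1)}"

definition generating_seq :: "('a, 'b) monoid_scheme \<Rightarrow> 'a list \<Rightarrow> bool" where
  "generating_seq G s \<longleftrightarrow> set s \<subseteq> carrier G \<and> generate G (set s) = carrier G"

definition irredundant_gen_seq :: "('a, 'b) monoid_scheme \<Rightarrow> 'a list \<Rightarrow> bool" where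
  "irredundant_gen_seq G s \<longleftrightarrow> generating_seq G s \<and>
     (\<forall>t. strict_subseq t s \<longrightarrow> \<not> generating_seq G t)"

definition max_irr :: "('a, 'b) monoid_scheme \<Rightarrow> nat" where
  "max_irr G = Max {length s | s. irredundant_gen_seq G s}"

definition witness_to_failure :: "('a, 'b) monoid_scheme \<Rightarrow> 'a \<Rightarrow> bool" where
  "witness_to_failure G g \<longleftrightarrow> g \<in> carrier G \<and> g \<noteq> \<one>\<^bsub>G\<^esub> \<and>
     (\<exists>s. irredundant_gen_seq G s \<and> length s = max_irr G \<and>
          (\<forall>i < length s. \<not> generating_seq G (s[i := g])))"

end

theory Submission
  imports Defs "HOL-Number_Theory.Quadratic_Reciprocity"
begin

text \<open>Work in SL(2,p) with centre Z = {1,-1}. Let g be a nontrivial element of PSL(2,p), lifted to SL(2,p),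
and let M_i be the preimage of the proper subgroup generated by g and all s_j with j \<noteq> i. No proper subgroup
contains two of the M_i. There are at least three of them, because three suitable involutions generate PSL(2,p)
whereas two involutions lie in a dihedral or abelian subgroup.

Suppose that the order of g in PSL(2,p) exceeds 2. A proper subgroup containing a noncentral element of trace 2
or -2 fixes a point of the projective line. In a subgroup without such elements the centralizer of a noncentral
element is abelian and has index at most 2 in its normalizer. Hence the class equation leaves only the subgroups
of the normalizer of the centralizer of g and groups of order 12, 24 and 60 modulo Z, in which g has order 3, 4
or 5. If some M_i is of the latter kind, then so is the subgroup generated by g and s_j for some j \<noteq> i, and comparing orders shows
that this group has index at most 2 in M_k for all k \<noteq> j; hence it is normal in G, which is impossible. The comparison
fails only if g has order 3 and a group of order 60 occurs; the latter contains an element of order 5, so that 5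
is a square modulo p. Otherwise each M_i fixes one of the at most two fixed points of g or lies in the
normalizer of the centralizer of g. As no two M_i lie in the same proper subgroup, there are exactly three
M_i, one of each kind; then all s_j commute with g, a contradiction.\<close>

section \<open>Groups and generating sequences\<close>

text \<open>Lifting to SL(2,p) matters because there the centralizer of every noncentral element is
  abelian, whereas in PSL(2,p) the centralizer of an involution is a nonabelian dihedral group. So
  commuting is an equivalence relation on noncentral elements, and the noncentral part of a subgroup
  splits into classes whose sizes are known. The price is that all orders double.

  Elements of order 2 escape the argument: when the centralizer of g in a subgroup has order 2
  modulo Z, dihedral groups of any order solve the class equation. For order 3 the obstacle is the
  pair of the groups of order 12 and 60, one inside the other with index 5; this is where 5 as a
  square modulo p comes in.

  The eigenvalues of g need not lie in the field with p elements. Instead of extending the field,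
  the normalizer of its centralizer is described as the set of elements that conjugate g to itself
  or to its inverse.

  The value m(G) is never computed; the bound 3 leaves two indices besides j in the exceptional case
  and three subgroups to compare at the end.\<close>

context group
begin

lemma inv_mult_cancel:
  assumes "y \<in> carrier G" "a \<in> carrier G"
  shows "y \<otimes> (inv y \<otimes> a) = a" "inv y \<otimes> (y \<otimes> a) = a"
  using assms by (simp_all add: m_assoc[symmetric])

lemma conj_mult:
  assumes "y \<in> carrier G" "a \<in> carrier G" "b \<in> carrier G"
  shows "y \<otimes> (a \<otimes> b) \<otimes> inv y = (y \<otimes> a \<otimes> inv y) \<otimes> (y \<otimes> b \<otimes> inv y)"
  using assms by (simp add: m_assoc inv_mult_cancel)

lemma conj_inv:
  assumes "y \<in> carrier G" "a \<in> carrier G"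
  shows "inv (y \<otimes> a \<otimes> inv y) = y \<otimes> inv a \<otimes> inv y"
  using assms by (simp add: m_assoc inv_mult_group)

lemma conj_conj:
  assumes "y \<in> carrier G" "z \<in> carrier G" "a \<in> carrier G"
  shows "(y \<otimes> z) \<otimes> a \<otimes> inv (y \<otimes> z) = y \<otimes> (z \<otimes> a \<otimes> inv z) \<otimes> inv y"
  using assms by (simp add: m_assoc inv_mult_group)

lemma conj_cancel:
  assumes "y \<in> carrier G" "a \<in> carrier G"
  shows "y \<otimes> (inv y \<otimes> a \<otimes> y) \<otimes> inv y = a" "inv y \<otimes> (y \<otimes> a \<otimes> inv y) \<otimes> y = a"
  using assms by (simp_all add: m_assoc inv_mult_cancel)

lemma subgroup_conj_preimage:
  assumes H: "subgroup H G" and y: "y \<in> carrier G"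
  shows "subgroup {x \<in> carrier G. y \<otimes> x \<otimes> inv y \<in> H} G"
proof (rule subgroupI)
  have "\<one> \<in> {x \<in> carrier G. y \<otimes> x \<otimes> inv y \<in> H}"
    using y subgroup.one_closed[OF H] by simp
  then show "{x \<in> carrier G. y \<otimes> x \<otimes> inv y \<in> H} \<noteq> {}" by blast
next
  fix a assume "a \<in> {x \<in> carrier G. y \<otimes> x \<otimes> inv y \<in> H}"
  then show "inv a \<in> {x \<in> carrier G. y \<otimes> x \<otimes> inv y \<in> H}"
    using subgroup.m_inv_closed[OF H] y by (auto simp: conj_inv[symmetric])
next
  fix a b assume "a \<in> {x \<in> carrier G. y \<otimes> x \<otimes> inv y \<in> H}" "b \<in> {x \<in> carrier G. y \<otimes> x \<otimes> inv y \<in> H}"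
  then show "a \<otimes> b \<in> {x \<in> carrier G. y \<otimes> x \<otimes> inv y \<in> H}"
    using subgroup.m_closed[OF H] y by (auto simp: conj_mult)
qed auto

text \<open>For a noncentral \<open>x\<close> of SL(2,p) that is not parabolic this is the
  normalizer of the centralizer of \<open>x\<close>, whether or not the eigenvalues of
  \<open>x\<close> lie in the prime field.\<close>

definition inverting :: "'a \<Rightarrow> 'a set" where
  "inverting x = {y \<in> carrier G. y \<otimes> x \<otimes> inv y = x \<or> y \<otimes> x \<otimes> inv y = inv x}"

lemma subgroup_inverting:
  assumes x: "x \<in> carrier G"
  shows "subgroup (inverting x) G"
proof (rule subgroupI)
  have "\<one> \<in> inverting x" using x by (simp add: inverting_def)
  then show "inverting x \<noteq> {}" by blast
next
  fix y assume "y \<in> inverting x"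
  then have y: "y \<in> carrier G" and *: "y \<otimes> x \<otimes> inv y = x \<or> y \<otimes> inv x \<otimes> inv y = x"
    using x by (auto simp: inverting_def conj_inv[symmetric])
  have "inv y \<otimes> x \<otimes> inv (inv y) = x \<or> inv y \<otimes> x \<otimes> inv (inv y) = inv x"
    using * conj_cancel(2)[OF y x] conj_cancel(2)[OF y inv_closed[OF x]] y by auto
  with y show "inv y \<in> inverting x" by (simp add: inverting_def)
next
  fix y z assume "y \<in> inverting x" "z \<in> inverting x"
  then show "y \<otimes> z \<in> inverting x"
    using x conj_inv[of y x] by (auto simp: inverting_def conj_conj simp del: inv_mult_group)
qed (simp add: inverting_def subset_iff)

lemma commute_iff_conj:
  assumes "x \<in> carrier G" "y \<in> carrier G"
  shows "y \<otimes> x \<otimes> inv y = x \<longleftrightarrow> y \<otimes> x = x \<otimes> y"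
  using assms by (metis inv_solve_right' m_closed)

end

lemma (in group) card_subgroup_dvd:
  assumes "subgroup I G" "subgroup J G" "I \<subseteq> J"
  shows "card I dvd card J"
proof -
  interpret J: group "G\<lparr>carrier := J\<rparr>"
    using assms(2) subgroup.subgroup_is_group is_group by blast
  have "card (rcosets\<^bsub>G\<lparr>carrier := J\<rparr>\<^esub> I) * card I = order (G\<lparr>carrier := J\<rparr>)"
    using J.lagrange[OF subgroup_incl[OF assms]] .
  then have "card J = card (rcosets\<^bsub>G\<lparr>carrier := J\<rparr>\<^esub> I) * card I" by (simp add: order_def)
  then show ?thesis by simp
qed

text \<open>If \<open>y\<close> conjugates \<open>x\<close> out of \<open>E\<close>, then
  \<open>y\<close> is outside \<open>E\<close>, and by counting \<open>E\<close> and its left coset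
  by \<open>y\<close> fill \<open>M\<close>. The conjugate lies in that coset, and cancelling
  \<open>y\<close> forces \<open>y\<close> into \<open>E\<close>. The inequality also covers
  \<open>M = E\<close>, so the exact index never has to be known.\<close>

lemma (in group) index_two_normalizes:
  assumes E: "subgroup E G" and M: "subgroup M G" and EM: "E \<subseteq> M"
    and fin: "finite M" and card: "card M \<le> 2 * card E" and y: "y \<in> M" and x: "x \<in> E"
  shows "y \<otimes> x \<otimes> inv y \<in> E"
proof (rule ccontr)
  assume z: "y \<otimes> x \<otimes> inv y \<notin> E"
  note carr = subgroup.mem_carrier[OF M] subgroup.mem_carrier[OF E]
  note closed = subgroup.m_closed[OF E] subgroup.m_inv_closed[OF E]
  note closedM = subgroup.m_closed[OF M] subgroup.m_inv_closed[OF M]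
  have yE: "y \<notin> E" using z x closed by blast
  have inj: "inj_on (\<lambda>e. y \<otimes> e) E" using y carr by (intro inj_onI) simp
  have "E \<inter> (\<lambda>e. y \<otimes> e) ` E = {}"
  proof (rule ccontr)
    assume "E \<inter> (\<lambda>e. y \<otimes> e) ` E \<noteq> {}"
    then obtain e where e: "e \<in> E" "y \<otimes> e \<in> E" by blast
    then have "y \<otimes> e \<otimes> inv e \<in> E" using closed by blast
    moreover have "y \<otimes> e \<otimes> inv e = y" using y e carr by (simp add: m_assoc)
    ultimately show False using yE by simp
  qed
  then have "card (E \<union> (\<lambda>e. y \<otimes> e) ` E) = 2 * card E"
    using fin EM card_image[OF inj] by (subst card_Un_disjoint) (auto intro: finite_subset)
  moreover have "E \<union> (\<lambda>e. y \<otimes> e) ` E \<subseteq> M" using EM y closedM by blast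
  ultimately have "E \<union> (\<lambda>e. y \<otimes> e) ` E = M" using card_subset_eq[OF fin] card card_mono[OF fin] by (metis le_antisym)
  moreover have "y \<otimes> x \<otimes> inv y \<in> M" using y x EM closedM by blast
  ultimately obtain e where e: "e \<in> E" "y \<otimes> x \<otimes> inv y = y \<otimes> e" using z by blast
  then have "x \<otimes> inv y = e" using y x carr by (simp add: m_assoc)
  then have "inv y = inv x \<otimes> e" using y x carr inv_mult_cancel(2)[of x "inv y"] by simp
  then have "inv y \<in> E" using x e closed by simp
  then have "inv (inv y) \<in> E" by (rule closed(2))
  then show False using yE y carr by simp
qed

text \<open>When \<open>E\<close> is a subgroup this is its normalizer; asking for both conjugations
  makes closure under inverses a matter of symmetry.\<close>

lemma (in group) subgroup_conj_stabalizing: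
  assumes E: "E \<subseteq> carrier G"
  shows "subgroup {y \<in> carrier G. \<forall>x\<in>E. y \<otimes> x \<otimes> inv y \<in> E \<and> inv y \<otimes> x \<otimes> y \<in> E} G"
proof (rule subgroupI)
  show "{y \<in> carrier G. \<forall>x\<in>E. y \<otimes> x \<otimes> inv y \<in> E \<and> inv y \<otimes> x \<otimes> y \<in> E} \<noteq> {}"
    using E by (auto simp: subset_iff intro!: exI[of _ \<one>])
next
  fix y z assume y: "y \<in> {y \<in> carrier G. \<forall>x\<in>E. y \<otimes> x \<otimes> inv y \<in> E \<and> inv y \<otimes> x \<otimes> y \<in> E}"
    and z: "z \<in> {y \<in> carrier G. \<forall>x\<in>E. y \<otimes> x \<otimes> inv y \<in> E \<and> inv y \<otimes> x \<otimes> y \<in> E}"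
  have "(y \<otimes> z) \<otimes> x \<otimes> inv (y \<otimes> z) \<in> E \<and> inv (y \<otimes> z) \<otimes> x \<otimes> (y \<otimes> z) \<in> E" if x: "x \<in> E" for x
  proof -
    have "(y \<otimes> z) \<otimes> x \<otimes> inv (y \<otimes> z) = y \<otimes> (z \<otimes> x \<otimes> inv z) \<otimes> inv y"
      "inv (y \<otimes> z) \<otimes> x \<otimes> (y \<otimes> z) = inv z \<otimes> (inv y \<otimes> x \<otimes> y) \<otimes> z"
      using y z x E by (auto simp: m_assoc inv_mult_group subset_iff)
    then show ?thesis using y z x by simp
  qed
  with y z show "y \<otimes> z \<in> {y \<in> carrier G. \<forall>x\<in>E. y \<otimes> x \<otimes> inv y \<in> E \<and> inv y \<otimes> x \<otimes> y \<in> E}" by simp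
qed auto

section \<open>Irredundant sequences and their maximal length\<close>

lemma irredundant_gen_seq_distinct:
  assumes "irredundant_gen_seq G s"
  shows "distinct s"
proof (rule ccontr)
  assume "\<not> distinct s"
  then obtain xs ys zs y where s: "s = xs @ [y] @ ys @ [y] @ zs" using not_distinct_decomp by blast
  let ?t = "xs @ [y] @ ys @ zs"
  have "strict_subseq ?t s"
    unfolding strict_subseq_def s by (auto intro!: list_emb_append_mono)
  moreover have "generating_seq G ?t"
    using assms by (simp add: irredundant_gen_seq_def generating_seq_def s)
  ultimately show False using assms by (auto simp: irredundant_gen_seq_def)
qed

lemma strict_subseq_triple:
  assumes "strict_subseq t [a, b, c]"
  shows "set t \<subseteq> {a, b} \<or> set t \<subseteq> {a, c} \<or> set t \<subseteq> {b, c}"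
proof -
  have "t \<in> set (subseqs [a, b, c])" "t \<noteq> [a, b, c]"
    using assms unfolding strict_subseq_def in_set_subseqs by blast+
  then show ?thesis by (auto simp: Let_def simp del: in_set_subseqs)
qed

text \<open>\<open>Max\<close> is informative only for a finite set; irredundant sequences have no
  repetitions, so the group order bounds their lengths.\<close>

lemma length_le_max_irr:
  assumes fin: "finite (carrier G)" and s: "irredundant_gen_seq G s"
  shows "length s \<le> max_irr G"
  unfolding max_irr_def
proof (rule Max_ge)
  have "length r \<le> card (carrier G)" if "irredundant_gen_seq G r" for r
    using that irredundant_gen_seq_distinct[OF that] card_mono[OF fin, of "set r"]
    by (simp add: irredundant_gen_seq_def generating_seq_def distinct_card)
  then have "{length r | r. irredundant_gen_seq G r} \<subseteq> {..card (carrier G)}" by auto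
  then show "finite {length r | r. irredundant_gen_seq G r}" using finite_subset by blast
qed (use s in blast)

section \<open>The class equation\<close>

text \<open>The cut at 6 comes from 1/2 + 1/3 + 1/6 = 1: in the class equation all larger
  denominators behave alike.\<close>

lemma unit_fraction_cases:
  assumes "m \<ge> 2"
  obtains "m = 2" "1 / real m = 1 / 2" | "m = 3" "1 / real m = 1 / 3" | "m = 4" "1 / real m = 1 / 4"
    | "m = 5" "1 / real m = 1 / 5" | "m \<ge> 6" "0 < 1 / real m" "1 / real m \<le> 1 / 6"
proof -
  from assms consider "m = 2" | "m = 3" | "m = 4" | "m = 5" | "m \<ge> 6" by linarith
  then show thesis using that by cases (auto simp: field_simps)
qed

text \<open>The solutions are the orders of the tetrahedral, octahedral and icosahedral rotation groups.\<close>
lemma class_equation_solutions: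
  fixes h n f n2 f2 n3 f3 :: nat
  assumes n: "n \<ge> 3" and f: "f = 1 \<or> f = 2" and h: "h \<ge> 2 * f * n"
    and kg: "kg = (1 - 1 / real n) / real f"
    and two: "kg + k2 = 1 - 1 / real h \<or> kg + k2 + k3 = 1 - 1 / real h"
    and k2: "k2 = (1 - 1 / real n2) / real f2" "n2 \<ge> 2" "f2 = 1 \<or> f2 = 2"
    and k3: "k3 = (1 - 1 / real n3) / real f3" "n3 \<ge> 2" "f3 = 1 \<or> f3 = 2"
  shows "n = 3 \<and> h \<in> {12, 24} \<or> n = 4 \<and> h = 24 \<or> n = 5 \<and> h = 60 \<or>
    n = 3 \<and> h = 60 \<and> (kg + k2 = 1 - 1 / real h \<and> n2 = 5 \<or> kg + k2 + k3 = 1 - 1 / real h \<and> (n2 = 5 \<or> n3 = 5))"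
proof -
  define a b c t where "a = 1 / real n" and "b = 1 / real n2" and "c = 1 / real n3" and "t = 1 / real h"
  have h0: "h > 0" using h n f by auto
  have t0: "t > 0" using h0 by (simp add: t_def)
  have "real (2 * f * n) \<le> real h" using h by (simp only: of_nat_le_iff)
  \<comment> \<open>Here the index of the normalizer of the centralizer, at least 2, enters.\<close>
  then have ta: "2 * real f * t \<le> a" using h0 n by (simp add: t_def a_def field_simps)
  have ht: "h = k" if "t = 1 / real k" for k
    using that h0 by (simp add: t_def)
  have a: "n = 3 \<and> a = 1 / 3 \<or> n = 4 \<and> a = 1 / 4 \<or> n = 5 \<and> a = 1 / 5 \<or> 0 < a \<and> a \<le> 1 / 6"
    by (rule unit_fraction_cases[of n]) (use n in \<open>auto simp: a_def\<close>)
  have b: "b = 1 / 2 \<or> b = 1 / 3 \<or> b = 1 / 4 \<or> n2 = 5 \<and> b = 1 / 5 \<or> 0 < b \<and> b \<le> 1 / 6"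
    using k2(2) by (rule unit_fraction_cases) (auto simp: b_def)
  have c: "c = 1 / 2 \<or> c = 1 / 3 \<or> c = 1 / 4 \<or> n3 = 5 \<and> c = 1 / 5 \<or> 0 < c \<and> c \<le> 1 / 6"
    using k3(2) by (rule unit_fraction_cases) (auto simp: c_def)
  have kg': "kg = (1 - a) / real f" and k2': "k2 = (1 - b) / real f2" and k3': "k3 = (1 - c) / real f3"
    using kg k2 k3 by (simp_all add: a_def b_def c_def)
  have k3q: "k3 \<ge> 1 / 4" using c k3(3) by (auto simp: k3')
  have k2q: "k2 \<ge> 1 / 4" using b k2(3) by (auto simp: k2')
  show ?thesis
  proof (cases "kg + k2 = 1 - t")
    case True
    from f show ?thesis
    proof
      \<comment> \<open>A centralizer that is its own normalizer leaves only the share a - t for the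
        other class, which needs at least 1/4; the tetrahedral group results.\<close>
      assume f1: "f = 1"
      then have e: "k2 = a - t" using True by (simp add: kg')
      then have n3: "n = 3" "a = 1 / 3" using k2q a t0 by auto
      have "f2 = 2" using k2(3) e n3 t0 b by (auto simp: k2')
      then have "b = 1 / 2" using b e n3 t0 by (auto simp: k2')
      then have "t = 1 / real 12" using e n3 \<open>f2 = 2\<close> by (simp add: k2')
      with ht[of 12] n3 show ?thesis by simp
    next
      \<comment> \<open>No class has a share strictly between 1/2 and 2/3: index 1 gives 1/2 or at
        least 2/3, index 2 gives less than 1/2.\<close>
      assume f2: "f = 2"
      then have e: "k2 = 1 / 2 + a / 2 - t" using True by (simp add: kg' field_simps)
      have t4: "4 * t \<le> a" using ta f2 by simp
      have "a \<le> 1 / 3" using a by auto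
      then have k2b: "k2 > 1 / 2" "k2 < 2 / 3" using e t4 t0 by linarith+
      have False using k2(3)
      proof
        assume "f2 = 1"
        then have "k2 = 1 - b" by (simp add: k2')
        with b k2b show False by (elim disjE conjE) simp_all
      next
        assume "f2 = 2"
        then have "k2 = (1 - b) / 2" by (simp add: k2')
        with b k2b show False by (elim disjE conjE) simp_all
      qed
      then show ?thesis ..
    qed
  next
    case False
    then have e: "kg + k2 + k3 = 1 - t" using two by (simp add: t_def)
    have "f \<noteq> 1" using e k2q k3q t0 a by (auto simp: kg')
    then have f2: "f = 2" using f by simp
    then have t4: "4 * t \<le> a" using ta by simp
    have e': "k2 + k3 = 1 / 2 + a / 2 - t" using e f2 by (simp add: kg' field_simps)
    have "f2 = 2" using k2(3) e' k3q t0 a b by (auto simp: k2')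
    moreover have "f3 = 2" using k3(3) e' k2q t0 a c by (auto simp: k3')
    \<comment> \<open>The equation of the finite rotation groups, 1/n + 1/n2 + 1/n3 = 1 +
      2/h.\<close>
    ultimately have s: "a + b + c = 1 + 2 * t" using e' by (simp add: k2' k3' field_simps)
    have "n = 3 \<and> (t = 1 / real 12 \<or> t = 1 / real 24) \<or> n = 4 \<and> t = 1 / real 24 \<or> n = 5 \<and> t = 1 / real 60 \<or>
      n = 3 \<and> t = 1 / real 60 \<and> (n2 = 5 \<or> n3 = 5)"
    proof -
      have t: "t = (a + b + c - 1) / 2" using s by simp
      have b3: "b \<le> 1 / 3 \<or> b = 1 / 2" and c3: "c \<le> 1 / 3 \<or> c = 1 / 2" using b c by auto
      have a3: "a \<le> 1 / 3" using a by auto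
      \<comment> \<open>Once one denominator is 2, the remaining one lies strictly between 2 and
        6.\<close>
      have low: "1 / 6 < u" "u < 1 / 2" if "a + u = 1 / 2 + 2 * t" for u
        using that a3 t0 t4 a by linarith+
      from b3 c3 consider "b = 1 / 2" | "c = 1 / 2" using s a3 t0 by fastforce
      then show ?thesis
      proof cases
        case 1
        then have u: "a + c = 1 / 2 + 2 * t" using s by simp
        then have "c = 1 / 3 \<or> c = 1 / 4 \<or> n3 = 5 \<and> c = 1 / 5" using c low[OF u] by auto
        then show ?thesis using a u t0 unfolding t 1 by (elim disjE conjE) simp_all
      next
        case 2
        then have u: "a + b = 1 / 2 + 2 * t" using s by simp
        then have "b = 1 / 3 \<or> b = 1 / 4 \<or> n2 = 5 \<and> b = 1 / 5" using b low[OF u] by auto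
        then show ?thesis using a u t0 unfolding t 2 by (elim disjE conjE) simp_all
      qed
    qed
    with ht[of 12] ht[of 24] ht[of 60] e[unfolded t_def] show ?thesis by blast
  qed
qed

text \<open>The axioms isolate what the count uses about a subgroup of SL(2,p) without parabolic
  elements. The last one reflects that commuting elements with the same trace are equal or inverse
  to each other.\<close>

locale paired_centralizers = group +
  fixes H Z
  assumes H: "subgroup H G" and finite_H: "finite H"
    and Z: "subgroup Z G" and Z_sub: "Z \<subseteq> H" and card_Z: "card Z = 2"
    and central: "z \<in> Z \<Longrightarrow> x \<in> H \<Longrightarrow> z \<otimes> x = x \<otimes> z"
    and centralizer_abelian: "\<lbrakk>x \<in> H; x \<notin> Z; y \<in> H; z \<in> H; x \<otimes> y = y \<otimes> x; x \<otimes> z = z \<otimes> x\<rbrakk> \<Longrightarrow> y \<otimes> z = z \<otimes> y"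
    and conj_commute: "\<lbrakk>x \<in> H; x \<notin> Z; y \<in> H; (y \<otimes> x \<otimes> inv y) \<otimes> x = x \<otimes> (y \<otimes> x \<otimes> inv y)\<rbrakk>
      \<Longrightarrow> y \<otimes> x \<otimes> inv y = x \<or> y \<otimes> x \<otimes> inv y = inv x"
begin

lemma H_carrier: "x \<in> H \<Longrightarrow> x \<in> carrier G"
  using subgroup.mem_carrier[OF H] .

lemma H_mult [simp]: "x \<in> H \<Longrightarrow> y \<in> H \<Longrightarrow> x \<otimes> y \<in> H"
  using subgroup.m_closed[OF H] .

lemma H_inv [simp]: "x \<in> H \<Longrightarrow> inv x \<in> H"
  using subgroup.m_inv_closed[OF H] .

definition cent where "cent x = {y \<in> H. y \<otimes> x = x \<otimes> y}"

text \<open>For \<open>x\<close> in \<open>H\<close> outside \<open>Z\<close> this is the normalizer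
  of \<open>cent x\<close> in \<open>H\<close>.\<close>

definition conj_stab where "conj_stab x = {y \<in> H. (y \<otimes> x \<otimes> inv y) \<otimes> x = x \<otimes> (y \<otimes> x \<otimes> inv y)}"

text \<open>For \<open>x\<close> in \<open>H\<close>, the union of the conjugates of
  \<open>cent x\<close> under \<open>H\<close>, with \<open>Z\<close> removed.\<close>

definition cls where
  "cls x = {y \<in> H - Z. \<exists>h\<in>H. (h \<otimes> y \<otimes> inv h) \<otimes> x = x \<otimes> (h \<otimes> y \<otimes> inv h)}"

lemma mult_cancel:
  assumes "y \<in> H" "a \<in> H"
  shows "y \<otimes> (inv y \<otimes> a) = a" "inv y \<otimes> (y \<otimes> a) = a"
  using assms inv_mult_cancel H_carrier by blast+

lemma conj_hom:
  assumes "y \<in> H" "a \<in> H" "b \<in> H"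
  shows "y \<otimes> (a \<otimes> b) \<otimes> inv y = (y \<otimes> a \<otimes> inv y) \<otimes> (y \<otimes> b \<otimes> inv y)"
  using assms conj_mult H_carrier by blast

lemma conj_commute_iff:
  assumes "y \<in> H" "a \<in> H" "b \<in> H"
  shows "(y \<otimes> a \<otimes> inv y) \<otimes> (y \<otimes> b \<otimes> inv y) = (y \<otimes> b \<otimes> inv y) \<otimes> (y \<otimes> a \<otimes> inv y) \<longleftrightarrow> a \<otimes> b = b \<otimes> a"
  using assms H_carrier by (simp add: conj_hom[symmetric])

lemma conj_twice:
  assumes "y \<in> H" "z \<in> H" "a \<in> H"
  shows "(y \<otimes> z) \<otimes> a \<otimes> inv (y \<otimes> z) = y \<otimes> (z \<otimes> a \<otimes> inv z) \<otimes> inv y"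
  using assms conj_conj H_carrier by blast

lemma conj_back:
  assumes "y \<in> H" "a \<in> H"
  shows "y \<otimes> (inv y \<otimes> a \<otimes> y) \<otimes> inv y = a" "inv y \<otimes> (y \<otimes> a \<otimes> inv y) \<otimes> y = a"
  using assms conj_cancel H_carrier by blast+

lemma conj_notin_Z:
  assumes "y \<in> H" "a \<in> H" "a \<notin> Z"
  shows "y \<otimes> a \<otimes> inv y \<notin> Z"
proof
  assume *: "y \<otimes> a \<otimes> inv y \<in> Z"
  have "a = inv y \<otimes> (y \<otimes> a \<otimes> inv y) \<otimes> y" using conj_back assms by simp
  also have "\<dots> = y \<otimes> a \<otimes> inv y"
    using central[OF * H_inv[OF assms(1)], symmetric] assms H_carrier by (simp add: m_assoc)
  finally show False using * assms by simp
qed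

text \<open>Abelian centralizers make commuting transitive through an element outside
  \<open>Z\<close>; this is what turns the sets \<open>cls x\<close> into a partition.\<close>

lemma commute_trans:
  assumes "x \<in> H" "x \<notin> Z" "y \<in> H" "z \<in> H" "y \<otimes> x = x \<otimes> y" "x \<otimes> z = z \<otimes> x"
  shows "y \<otimes> z = z \<otimes> y"
  using centralizer_abelian[OF assms(1-4) assms(5)[symmetric] assms(6)] .

lemma subgroup_cent:
  assumes x: "x \<in> H"
  shows "subgroup (cent x) G"
proof (rule subgroupI)
  show "cent x \<subseteq> carrier G" using H_carrier by (auto simp: cent_def)
  have "\<one> \<in> cent x" using x H_carrier subgroup.one_closed[OF H] by (simp add: cent_def)
  then show "cent x \<noteq> {}" by blast
next
  fix y assume "y \<in> cent x"
  then have y: "y \<in> H" "y \<otimes> x = x \<otimes> y" by (auto simp: cent_def)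
  have "inv y \<otimes> (y \<otimes> x) \<otimes> inv y = inv y \<otimes> (x \<otimes> y) \<otimes> inv y" by (simp only: y(2))
  then have "x \<otimes> inv y = inv y \<otimes> x" using x y(1) H_carrier mult_cancel by (simp add: m_assoc)
  with y(1) show "inv y \<in> cent x" by (simp add: cent_def)
next
  fix y z assume "y \<in> cent x" "z \<in> cent x"
  then have yz: "y \<in> H" "y \<otimes> x = x \<otimes> y" "z \<in> H" "z \<otimes> x = x \<otimes> z" by (auto simp: cent_def)
  have "y \<otimes> z \<otimes> x = y \<otimes> (z \<otimes> x)" using yz x H_carrier by (simp only: m_assoc)
  also have "\<dots> = y \<otimes> x \<otimes> z" unfolding yz(4) using yz(1,3) x H_carrier by (simp only: m_assoc)
  also have "\<dots> = x \<otimes> (y \<otimes> z)" unfolding yz(2) using yz(1,3) x H_carrier by (simp only: m_assoc)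
  finally show "y \<otimes> z \<in> cent x" using yz by (simp add: cent_def)
qed

lemma Z_cent: "x \<in> H \<Longrightarrow> Z \<subseteq> cent x"
  using Z_sub central by (auto simp: cent_def)

lemma conj_stab_eq:
  assumes "x \<in> H" "x \<notin> Z"
  shows "conj_stab x = {y \<in> H. y \<otimes> x \<otimes> inv y = x \<or> y \<otimes> x \<otimes> inv y = inv x}"
  using conj_commute[OF assms] assms H_carrier by (auto simp: conj_stab_def)

lemma cent_conj: 
  assumes "x \<in> H" shows "cent x = {y \<in> H. y \<otimes> x \<otimes> inv y = x}"
proof -
  have "y \<otimes> x = x \<otimes> y \<longleftrightarrow> y \<otimes> x \<otimes> inv y = x" if "y \<in> H" for y
    using that assms H_carrier by (metis inv_solve_right' m_closed)
  then show ?thesis by (auto simp: cent_def)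
qed

lemma conj_inv':
  assumes "y \<in> H" "x \<in> H" shows "inv (y \<otimes> x \<otimes> inv y) = y \<otimes> inv x \<otimes> inv y"
  using assms conj_inv H_carrier by blast

lemma subgroup_conj_stab:
  assumes x: "x \<in> H" "x \<notin> Z"
  shows "subgroup (conj_stab x) G"
proof (rule subgroupI)
  show "conj_stab x \<subseteq> carrier G" using H_carrier by (auto simp: conj_stab_def)
  have "\<one> \<in> conj_stab x" using x(1) H_carrier subgroup.one_closed[OF H] by (simp add: conj_stab_def)
  then show "conj_stab x \<noteq> {}" by blast
next
  fix y assume "y \<in> conj_stab x"
  then have y: "y \<in> H" "y \<otimes> x \<otimes> inv y = x \<or> y \<otimes> inv x \<otimes> inv y = x"
    using x H_carrier by (auto simp: conj_stab_eq conj_inv'[symmetric])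
  then have "inv y \<otimes> x \<otimes> inv (inv y) = x \<or> inv y \<otimes> x \<otimes> inv (inv y) = inv x"
    using conj_back(2)[OF y(1) x(1)] conj_back(2)[OF y(1) H_inv[OF x(1)]] H_carrier by auto
  with x y(1) show "inv y \<in> conj_stab x" by (simp add: conj_stab_eq)
next
  fix y z assume "y \<in> conj_stab x" "z \<in> conj_stab x"
  then show "y \<otimes> z \<in> conj_stab x"
    using x H_carrier conj_inv'[of y x] by (auto simp: conj_stab_eq conj_twice simp del: inv_mult_group)
qed

text \<open>The elements that send \<open>x\<close> to its inverse but not to itself form one coset
  of \<open>cent x\<close>, if there are any.\<close>

lemma card_conj_stab:
  assumes x: "x \<in> H" "x \<notin> Z"
  shows "card (conj_stab x) = card (cent x) \<or> card (conj_stab x) = 2 * card (cent x)"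
proof (cases "conj_stab x = cent x")
  case False
  have sub: "cent x \<subseteq> conj_stab x" using x by (auto simp: cent_conj conj_stab_eq)
  with False obtain w where w: "w \<in> conj_stab x" "w \<notin> cent x" by blast
  then have w': "w \<in> H" "w \<otimes> x \<otimes> inv w = inv x" using x by (auto simp: conj_stab_eq cent_conj)
  have "bij_betw (\<lambda>y. w \<otimes> y) (cent x) (conj_stab x - cent x)"
  proof (rule bij_betw_byWitness[where f' = "\<lambda>y. inv w \<otimes> y"])
    show "\<forall>a\<in>cent x. inv w \<otimes> (w \<otimes> a) = a" "\<forall>a'\<in>conj_stab x - cent x. w \<otimes> (inv w \<otimes> a') = a'"
      using w'(1) mult_cancel by (auto simp: cent_def conj_stab_def)
    show "(\<lambda>y. w \<otimes> y) ` cent x \<subseteq> conj_stab x - cent x"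
    proof safe
      fix y assume y: "y \<in> cent x"
      show "w \<otimes> y \<in> conj_stab x" using w(1) y sub subgroup.m_closed[OF subgroup_conj_stab[OF x]] by blast
      assume "w \<otimes> y \<in> cent x"
      then have "w \<otimes> y \<otimes> inv y \<in> cent x"
        using y subgroup.m_closed[OF subgroup_cent] subgroup.m_inv_closed[OF subgroup_cent] x(1) by blast
      moreover have "w \<otimes> y \<otimes> inv y = w" using y w' H_carrier by (simp add: m_assoc cent_def)
      ultimately show False using w(2) by simp
    qed
    show "(\<lambda>y. inv w \<otimes> y) ` (conj_stab x - cent x) \<subseteq> cent x"
    proof safe
      fix y assume y: "y \<in> conj_stab x" "y \<notin> cent x"
      then have y': "y \<in> H" "y \<otimes> x \<otimes> inv y = inv x" using x by (auto simp: conj_stab_eq cent_conj)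
      have "inv w \<otimes> y \<otimes> x \<otimes> inv (inv w \<otimes> y) = inv w \<otimes> inv x \<otimes> inv (inv w)"
        using y' w'(1) x conj_twice by simp
      also have "\<dots> = x" using conj_back(2)[OF w'(1) x(1)] w' H_carrier by simp
      finally show "inv w \<otimes> y \<in> cent x" using x y' w' by (simp add: cent_conj)
    qed
  qed
  then have "card (conj_stab x - cent x) = card (cent x)" by (metis bij_betw_same_card)
  moreover have "card (conj_stab x) = card (conj_stab x - cent x) + card (cent x)"
    using sub finite_H card_Diff_subset[of "cent x" "conj_stab x"] card_mono[of "conj_stab x" "cent x"]
    by (simp add: cent_def conj_stab_def)
  ultimately show ?thesis by simp
qed simp

text \<open>The order of \<open>Z\<close> divides that of \<open>cent x\<close>, and
  \<open>x\<close> is a third element besides the two of \<open>Z\<close>. Here \<open>n\<close> is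
  the order of the centralizer modulo \<open>Z\<close>.\<close>

lemma card_cent:
  assumes x: "x \<in> H" "x \<notin> Z"
  obtains n where "card (cent x) = 2 * n" "n \<ge> 2"
proof -
  have "2 dvd card (cent x)" using card_subgroup_dvd[OF Z subgroup_cent Z_cent] x card_Z by auto
  then obtain n where n: "card (cent x) = 2 * n" by (elim dvdE)
  have "card (insert x Z) \<le> card (cent x)"
    using x Z_cent finite_H by (intro card_mono) (auto simp: cent_def)
  moreover have "card (insert x Z) = 3" using x card_Z by (simp add: card_ge_0_finite)
  ultimately show thesis using n that by simp
qed

text \<open>Elements of \<open>cent x\<close> outside \<open>Z\<close> have the same centralizer as
  \<open>x\<close>, so whether \<open>n\<close> normalizes \<open>cent x\<close> can be tested on
  any of them.\<close>

lemma conj_in_cent_iff: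
  assumes x: "x \<in> H" "x \<notin> Z" and a: "a \<in> cent x" "a \<notin> Z" and n: "n \<in> H"
  shows "n \<otimes> a \<otimes> inv n \<in> cent x \<longleftrightarrow> n \<in> conj_stab x"
proof -
  have aH: "a \<in> H" and ax: "a \<otimes> x = x \<otimes> a" using a by (auto simp: cent_def)
  let ?c = "\<lambda>u. n \<otimes> u \<otimes> inv n"
  have c: "?c a \<in> H" "?c x \<in> H" "?c a \<notin> Z" "?c x \<notin> Z" using conj_notin_Z x a aH n by auto
  have cc: "?c a \<otimes> ?c x = ?c x \<otimes> ?c a" using conj_commute_iff[OF n aH x(1)] ax by simp
  have "?c a \<otimes> x = x \<otimes> ?c a \<longleftrightarrow> ?c x \<otimes> x = x \<otimes> ?c x"
    using commute_trans[OF c(1,3) c(2) x(1) cc[symmetric]] commute_trans[OF c(2,4) c(1) x(1) cc] by blast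
  then show ?thesis using c n by (simp add: cent_def conj_stab_def)
qed

text \<open>Conjugation maps pairs of an element of \<open>H\<close> and an element of
  \<open>cent x\<close> outside \<open>Z\<close> onto \<open>cls x\<close>, and every fibre is in
  bijection with \<open>conj_stab x\<close>.\<close>

lemma card_cls:
  assumes x: "x \<in> H" "x \<notin> Z"
  shows "card (cls x) * card (conj_stab x) = card H * (card (cent x) - 2)"
proof -
  let ?S = "H \<times> (cent x - Z)"
  let ?\<phi> = "\<lambda>(h, a). h \<otimes> a \<otimes> inv h"
  have fin: "finite (cent x)" using finite_H by (simp add: cent_def)
  have sub: "?\<phi> ` ?S \<subseteq> cls x"
  proof safe
    fix h a assume h: "h \<in> H" "a \<in> cent x" "a \<notin> Z"
    then have a: "a \<in> H" "a \<otimes> x = x \<otimes> a" by (auto simp: cent_def)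
    have "inv h \<otimes> (h \<otimes> a \<otimes> inv h) \<otimes> inv (inv h) = a" using h a conj_back H_carrier by simp
    then show "h \<otimes> a \<otimes> inv h \<in> cls x"
      using h a conj_notin_Z unfolding cls_def by (auto intro!: bexI[of _ "inv h"])
  qed
  have fibre: "card {q \<in> ?S. ?\<phi> q = y} = card (conj_stab x)" if y: "y \<in> cls x" for y
  proof -
    obtain h where h: "h \<in> H" "(h \<otimes> y \<otimes> inv h) \<otimes> x = x \<otimes> (h \<otimes> y \<otimes> inv h)" and yH: "y \<in> H" "y \<notin> Z"
      using y by (auto simp: cls_def)
    let ?a = "h \<otimes> y \<otimes> inv h"
    have a: "?a \<in> cent x" "?a \<notin> Z" using h yH conj_notin_Z by (auto simp: cent_def)
    have aH: "?a \<in> H" using h yH by simp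
    have conj: "inv (inv h \<otimes> n) \<otimes> y \<otimes> (inv h \<otimes> n) = inv n \<otimes> ?a \<otimes> n" if "n \<in> H" for n
      using that h yH H_carrier by (simp add: m_assoc inv_mult_group)
    \<comment> \<open>Since \<open>h\<close> moves \<open>y\<close> to the element \<open>?a\<close>
      of \<open>cent x\<close>, every pair over \<open>y\<close> arises from \<open>inv h\<close> by
      a further factor \<open>n\<close> that normalizes \<open>cent x\<close>.\<close>
    have "bij_betw (\<lambda>n. (inv h \<otimes> n, inv n \<otimes> ?a \<otimes> n)) (conj_stab x) {q \<in> ?S. ?\<phi> q = y}"
    proof (rule bij_betw_byWitness[where f' = "\<lambda>q. h \<otimes> fst q"])
      show "\<forall>n\<in>conj_stab x. h \<otimes> fst (inv h \<otimes> n, inv n \<otimes> ?a \<otimes> n) = n"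
        using h mult_cancel by (auto simp: conj_stab_def)
      show "(\<lambda>n. (inv h \<otimes> n, inv n \<otimes> ?a \<otimes> n)) ` conj_stab x \<subseteq> {q \<in> ?S. ?\<phi> q = y}"
      proof (rule image_subsetI)
        fix n assume n: "n \<in> conj_stab x"
        then have nH: "n \<in> H" by (simp add: conj_stab_def)
        have "inv n \<in> conj_stab x" using n subgroup.m_inv_closed[OF subgroup_conj_stab[OF x]] by blast
        then have "inv n \<otimes> ?a \<otimes> n \<in> cent x"
          using conj_in_cent_iff[OF x a, of "inv n"] nH H_carrier by simp
        moreover have "inv n \<otimes> ?a \<otimes> n \<notin> Z" using conj_notin_Z[of "inv n" ?a] nH a aH H_carrier by simp
        moreover have "(inv h \<otimes> n) \<otimes> (inv n \<otimes> ?a \<otimes> n) \<otimes> inv (inv h \<otimes> n) = y"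
          using conj_back(1)[of "inv h \<otimes> n" y] h nH yH conj[OF nH] by simp
        ultimately show "(inv h \<otimes> n, inv n \<otimes> ?a \<otimes> n) \<in> {q \<in> ?S. ?\<phi> q = y}" using h nH by simp
      qed
      have main: "h \<otimes> k \<in> conj_stab x \<and> inv (h \<otimes> k) \<otimes> ?a \<otimes> (h \<otimes> k) = b"
        if k: "k \<in> H" and b: "b \<in> cent x" "b \<notin> Z" and kb: "k \<otimes> b \<otimes> inv k = y" for k b
      proof -
        have bH: "b \<in> H" using b by (simp add: cent_def)
        have e: "(h \<otimes> k) \<otimes> b \<otimes> inv (h \<otimes> k) = ?a" using conj_twice[OF h(1) k bH] kb by simp
        with conj_in_cent_iff[OF x b, of "h \<otimes> k"] a h k have "h \<otimes> k \<in> conj_stab x" by simp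
        moreover have "inv (h \<otimes> k) \<otimes> ?a \<otimes> (h \<otimes> k) = b"
          using conj_back(2)[of "h \<otimes> k" b] h k bH e by simp
        ultimately show ?thesis by simp
      qed
      show "\<forall>q\<in>{q \<in> ?S. ?\<phi> q = y}. (inv h \<otimes> (h \<otimes> fst q), inv (h \<otimes> fst q) \<otimes> ?a \<otimes> (h \<otimes> fst q)) = q"
      proof
        fix q assume "q \<in> {q \<in> ?S. ?\<phi> q = y}"
        then obtain k b where q: "q = (k, b)" "k \<in> H" "b \<in> cent x" "b \<notin> Z" "k \<otimes> b \<otimes> inv k = y" by auto
        show "(inv h \<otimes> (h \<otimes> fst q), inv (h \<otimes> fst q) \<otimes> ?a \<otimes> (h \<otimes> fst q)) = q"
          unfolding q(1) fst_conv using main[OF q(2-5)] mult_cancel(2)[OF h(1) q(2)] by (simp only:)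
      qed
      show "(\<lambda>q. h \<otimes> fst q) ` {q \<in> ?S. ?\<phi> q = y} \<subseteq> conj_stab x"
      proof (rule image_subsetI)
        fix q assume "q \<in> {q \<in> ?S. ?\<phi> q = y}"
        then obtain k b where q: "q = (k, b)" "k \<in> H" "b \<in> cent x" "b \<notin> Z" "k \<otimes> b \<otimes> inv k = y" by auto
        show "h \<otimes> fst q \<in> conj_stab x" unfolding q(1) fst_conv using main[OF q(2-5)] by blast
      qed
    qed
    from bij_betw_same_card[OF this, symmetric] show ?thesis .
  qed
  have "card ?S = (\<Sum>q\<in>?S. 1)" by simp
  also have "\<dots> = (\<Sum>y\<in>cls x. \<Sum>q\<in>{q \<in> ?S. ?\<phi> q = y}. 1)"
    using sub finite_H fin by (intro sum.group[symmetric]) (auto simp: cls_def)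
  also have "\<dots> = (\<Sum>y\<in>cls x. card (conj_stab x))" using fibre by (intro sum.cong) auto
  finally have "card (cls x) * card (conj_stab x) = card ?S" by simp
  also have "\<dots> = card H * (card (cent x) - 2)"
    using Z_cent[OF x(1)] card_Z fin by (simp add: card_cartesian_product card_Diff_subset card_ge_0_finite)
  finally show ?thesis .
qed

lemma cls_sym:
  assumes x: "x \<in> H" "x \<notin> Z" and y: "y \<in> cls x"
  shows "x \<in> cls y"
proof -
  obtain h where h: "h \<in> H" "(h \<otimes> y \<otimes> inv h) \<otimes> x = x \<otimes> (h \<otimes> y \<otimes> inv h)" and yH: "y \<in> H" "y \<notin> Z"
    using y by (auto simp: cls_def)
  have "h \<otimes> (inv h \<otimes> x \<otimes> h) \<otimes> inv h = x" using conj_back x h by simp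
  then have "(inv h \<otimes> x \<otimes> h) \<otimes> y = y \<otimes> (inv h \<otimes> x \<otimes> h)"
    using conj_commute_iff[of h "inv h \<otimes> x \<otimes> h" y] h x yH by simp
  then show ?thesis using x h H_carrier unfolding cls_def by (auto intro!: bexI[of _ "inv h"])
qed

lemma cls_trans:
  assumes x: "x \<in> H" "x \<notin> Z" and y: "y \<in> cls x" and z: "z \<in> cls y"
  shows "z \<in> cls x"
proof -
  obtain h where h: "h \<in> H" "(h \<otimes> y \<otimes> inv h) \<otimes> x = x \<otimes> (h \<otimes> y \<otimes> inv h)" and yH: "y \<in> H" "y \<notin> Z"
    using y by (auto simp: cls_def)
  obtain k where k: "k \<in> H" "(k \<otimes> z \<otimes> inv k) \<otimes> y = y \<otimes> (k \<otimes> z \<otimes> inv k)" and zH: "z \<in> H" "z \<notin> Z"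
    using z by (auto simp: cls_def)
  have "(h \<otimes> (k \<otimes> z \<otimes> inv k) \<otimes> inv h) \<otimes> (h \<otimes> y \<otimes> inv h) = (h \<otimes> y \<otimes> inv h) \<otimes> (h \<otimes> (k \<otimes> z \<otimes> inv k) \<otimes> inv h)"
    using conj_commute_iff[of h "k \<otimes> z \<otimes> inv k" y] h k zH yH by simp
  from commute_trans[OF _ _ _ _ this h(2)] have
    "(h \<otimes> (k \<otimes> z \<otimes> inv k) \<otimes> inv h) \<otimes> x = x \<otimes> (h \<otimes> (k \<otimes> z \<otimes> inv k) \<otimes> inv h)"
    using h k zH yH x conj_notin_Z by simp
  then show ?thesis using zH h k conj_twice unfolding cls_def by (auto intro!: bexI[of _ "h \<otimes> k"])
qed

lemma cls_disjoint:
  assumes "x \<in> H" "x \<notin> Z" "y \<in> H" "y \<notin> Z" "y \<notin> cls x"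
  shows "cls x \<inter> cls y = {}"
proof (rule ccontr)
  assume "cls x \<inter> cls y \<noteq> {}"
  then obtain z where z: "z \<in> cls x" "z \<in> cls y" by blast
  then have "y \<in> cls z" using cls_sym assms by blast
  with z assms cls_trans show False by blast
qed

text \<open>Dividing the count by the order of \<open>H\<close> leaves a share that depends only on
  the order \<open>n\<close> of the centralizer modulo \<open>Z\<close> and on its index
  \<open>f\<close> in its normalizer.\<close>

lemma cls_ratio:
  assumes x: "x \<in> H" "x \<notin> Z"
  obtains n f :: nat where "card (cent x) = 2 * n" "n \<ge> 2" "f = 1 \<or> f = 2" "card (conj_stab x) = f * (2 * n)"
    "real (card (cls x)) / real (card H) = (1 - 1 / real n) / real f"
proof -
  obtain n where n: "card (cent x) = 2 * n" "n \<ge> 2" using card_cent[OF x] .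
  obtain f :: nat where f: "f = 1 \<or> f = 2" "card (conj_stab x) = f * (2 * n)"
    using card_conj_stab[OF x] n(1) by (metis mult_1)
  have H0: "card H > 0" using finite_H x by (auto simp: card_gt_0_iff)
  have "real (card (cls x)) * real (f * (2 * n)) = real (card H) * (2 * real n - 2)"
    using arg_cong[OF card_cls[OF x], of real] n f by (simp add: of_nat_diff)
  then have "real (card (cls x)) / real (card H) = (1 - 1 / real n) / real f"
    using n f(1) H0 by (auto simp: field_simps)
  with n f show thesis by (intro that)
qed

text \<open>The shares of the classes add up to that of \<open>H - Z\<close>, and each is at least
  1/4, so only two or three classes occur. The orders are twice those of the rotation groups, since
  \<open>Z\<close> is included.\<close>

theorem exceptional_orders:
  assumes g: "g \<in> H" "g \<notin> Z" and c: "card (cent g) > 4" and exc: "conj_stab g \<noteq> H"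
  shows "card (cent g) = 6 \<and> card H \<in> {24, 48} \<or> card (cent g) = 8 \<and> card H = 48 \<or>
    card (cent g) = 10 \<and> card H = 120 \<or>
    card (cent g) = 6 \<and> card H = 120 \<and> (\<exists>y\<in>H - Z. card (cent y) = 10)"
proof -
  have H0: "card H > 0" using finite_H g by (auto simp: card_gt_0_iff)
  define \<kappa> where "\<kappa> x = real (card (cls x)) / real (card H)" for x
  obtain n f where n: "card (cent g) = 2 * n" "n \<ge> 2" "f = 1 \<or> f = 2" "card (conj_stab g) = f * (2 * n)"
    "\<kappa> g = (1 - 1 / real n) / real f"
    using cls_ratio[OF g, folded \<kappa>_def] .
  have n3: "n \<ge> 3" using c n by simp
  have "2 dvd card H" using card_subgroup_dvd[OF Z H Z_sub] card_Z by simp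
  then obtain h where h: "card H = 2 * h" by (elim dvdE)
  have "card (conj_stab g) dvd card H"
    using card_subgroup_dvd[OF subgroup_conj_stab[OF g] H] by (auto simp: conj_stab_def)
  then obtain q where q: "card H = card (conj_stab g) * q" by (elim dvdE)
  have "card (conj_stab g) < card H"
    using exc finite_H by (intro psubset_card_mono) (auto simp: conj_stab_def)
  with q have "q \<ge> 2" by (cases q) auto
  then have "card H \<ge> card (conj_stab g) * 2" using q by simp
  then have hn: "h \<ge> 2 * f * n" using h n(4) by simp
  have "card (H - Z) = 2 * h - 2"
    using card_Diff_subset[OF finite_subset[OF Z_sub finite_H] Z_sub] card_Z h by simp
  then have cH: "real (card (H - Z)) / real (card H) = 1 - 1 / real h"
    using H0 h by (simp add: of_nat_diff field_simps)
  have sub: "cls x \<subseteq> H - Z" for x by (auto simp: cls_def)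
  have fin: "finite (H - Z)" using finite_H by simp
  have fin': "finite (cls x)" for x using finite_subset[OF sub fin] .
  have quarter: "\<kappa> x \<ge> 1 / 4" if "x \<in> H - Z" for x
  proof -
    have x: "x \<in> H" "x \<notin> Z" using that by auto
    obtain m e :: nat where "card (cent x) = 2 * m" and m: "m \<ge> 2" "e = 1 \<or> e = 2"
      and "card (conj_stab x) = e * (2 * m)" and \<kappa>: "\<kappa> x = (1 - 1 / real m) / real e"
      using cls_ratio[OF x, folded \<kappa>_def] .
    have "1 / real m \<le> 1 / 2" using m(1) by (simp add: field_simps)
    then show ?thesis using m(2) by (auto simp: \<kappa>)
  qed
  have third: "\<kappa> g \<ge> 1 / 3" unfolding n(5) using n3 n(3) by (auto simp: field_simps)
  \<comment> \<open>The index bound keeps the class of \<open>g\<close> from filling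
    \<open>H - Z\<close>, so there is a second class.\<close>
  have less: "\<kappa> g \<noteq> 1 - 1 / real h"
  proof -
    have "real (2 * f * n) \<le> real h" using hn by (simp only: of_nat_le_iff)
    then have *: "2 * real f * (1 / real h) \<le> 1 / real n" "0 < 1 / real h" "1 / real n \<le> 1 / 3"
      using n3 n(3) by (auto simp: field_simps)
    define a t where "a = 1 / real n" and "t = 1 / real h"
    have "2 * real f * t \<le> a" "0 < t" "a \<le> 1 / 3" using * by (simp_all only: a_def t_def)
    then have "(1 - a) / real f \<noteq> 1 - t" using n(3) by auto
    then show ?thesis unfolding n(5) a_def t_def .
  qed
  have *: "real (card A) / real (card H) + \<kappa> x = real (card (A \<union> cls x)) / real (card H)"
    if "A \<inter> cls x = {}" "finite A" for A x
    using card_Un_disjoint[OF that(2) fin' that(1)] by (simp add: \<kappa>_def add_divide_distrib)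
  have "cls g \<noteq> H - Z" using less cH by (auto simp: \<kappa>_def)
  then obtain y2 where y2: "y2 \<in> H - Z" "y2 \<notin> cls g" using sub[of g] by blast
  let ?A2 = "cls g \<union> cls y2"
  have d2: "cls g \<inter> cls y2 = {}" using cls_disjoint g y2 by blast
  have s2: "\<kappa> g + \<kappa> y2 = real (card ?A2) / real (card H)"
    using *[OF d2 fin'] by (simp add: \<kappa>_def)
  have y2': "y2 \<in> H" "y2 \<notin> Z" using y2 by auto
  obtain n2 f2 where n2: "card (cent y2) = 2 * n2" "n2 \<ge> 2" "f2 = 1 \<or> f2 = 2"
    "card (conj_stab y2) = f2 * (2 * n2)" "\<kappa> y2 = (1 - 1 / real n2) / real f2"
    using cls_ratio[OF y2', folded \<kappa>_def] .
  show ?thesis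
  proof (cases "?A2 = H - Z")
    case True
    then have "\<kappa> g + \<kappa> y2 = 1 - 1 / real h" using s2 cH by simp
    \<comment> \<open>With two classes the data of \<open>y2\<close> also fill the place of the
      third summand.\<close>
    from class_equation_solutions[OF n3 n(3) hn n(5) disjI1[OF this] n2(5,2,3) n2(5,2,3)]
    have "n = 3 \<and> h \<in> {12, 24} \<or> n = 4 \<and> h = 24 \<or> n = 5 \<and> h = 60 \<or> n = 3 \<and> h = 60 \<and> n2 = 5"
      by blast
    moreover have "\<exists>y\<in>H - Z. card (cent y) = 10" if "n2 = 5" using that n2(1) y2 by auto
    ultimately show ?thesis using n(1) h by auto
  next
    case False
    then obtain y3 where y3: "y3 \<in> H - Z" "y3 \<notin> ?A2" using sub by blast
    let ?A3 = "?A2 \<union> cls y3"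
    have d3: "?A2 \<inter> cls y3 = {}" using cls_disjoint g y2 y3 by blast
    have s3: "\<kappa> g + \<kappa> y2 + \<kappa> y3 = real (card ?A3) / real (card H)"
      using *[OF d3] fin' s2 by simp
    have y3': "y3 \<in> H" "y3 \<notin> Z" using y3 by auto
    obtain n3' f3 where n3': "card (cent y3) = 2 * n3'" "n3' \<ge> 2" "f3 = 1 \<or> f3 = 2"
      "card (conj_stab y3) = f3 * (2 * n3')" "\<kappa> y3 = (1 - 1 / real n3') / real f3"
      using cls_ratio[OF y3', folded \<kappa>_def] .
    have "?A3 = H - Z"
    proof (rule ccontr)
      \<comment> \<open>A fourth class is excluded by 1/3 + 3/4 > 1.\<close>
      assume "?A3 \<noteq> H - Z"
      then obtain y4 where y4: "y4 \<in> H - Z" "y4 \<notin> ?A3" using sub by blast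
      have d4: "?A3 \<inter> cls y4 = {}" using cls_disjoint g y2 y3 y4 by blast
      have "\<kappa> g + \<kappa> y2 + \<kappa> y3 + \<kappa> y4 = real (card (?A3 \<union> cls y4)) / real (card H)"
        using *[OF d4] fin' s3 by simp
      also have "\<dots> \<le> real (card (H - Z)) / real (card H)"
        using card_mono[OF fin, of "?A3 \<union> cls y4"] sub by (intro divide_right_mono) auto
      also have "\<dots> < 1" using cH hn n3 n(3) by auto
      finally show False using third quarter[OF y2(1)] quarter[OF y3(1)] quarter[OF y4(1)] by simp
    qed
    then have "\<kappa> g + \<kappa> y2 + \<kappa> y3 = 1 - 1 / real h" using s3 cH by simp
    from class_equation_solutions[OF n3 n(3) hn n(5) disjI2[OF this] n2(5,2,3) n3'(5,2,3)]
    have "n = 3 \<and> h \<in> {12, 24} \<or> n = 4 \<and> h = 24 \<or> n = 5 \<and> h = 60 \<or>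
      n = 3 \<and> h = 60 \<and> (n2 = 5 \<or> n3' = 5)"
      by blast
    moreover have "\<exists>y\<in>H - Z. card (cent y) = 10" if "n2 = 5 \<or> n3' = 5"
      using that n2(1) y2 n3'(1) y3 by auto
    ultimately show ?thesis using n(1) h by auto
  qed
qed

end

section \<open>Matrices modulo p\<close>

text \<open>Since (5 - 1) div 2 is even, the reciprocity sign is 1 and \<open>p\<close> is a square
  modulo 5, hence 1 or 4 there; oddness of \<open>p\<close> lifts this to modulus 10.\<close>

lemma five_square_mod_10:
  fixes p w :: int
  assumes p: "Factorial_Ring.prime p" "p > 5" and w: "p dvd w\<^sup>2 - 5"
  shows "p mod 10 = 1 \<or> p mod 10 = 9"
proof -
  have n5: "\<not> p dvd 5" using p(2) zdvd_imp_le[of p 5] by auto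
  then have "Legendre 5 p = 1"
    using w by (auto simp: Legendre_def QuadRes_def cong_iff_dvd_diff)
  moreover have "Legendre p 5 * Legendre 5 p = (-1) ^ nat ((p - 1) div 2 * ((5 - 1) div 2))"
    using p by (intro Quadratic_Reciprocity_int) auto
  moreover have "nat ((p - 1) div 2 * ((5 - 1) div 2)) = 2 * nat ((p - 1) div 2)"
    using p(2) by (simp add: nat_mult_distrib)
  ultimately have "Legendre p 5 = 1" by simp
  then obtain y where "[y\<^sup>2 = p] (mod 5)" and np: "\<not> [p = 0] (mod 5)"
    by (auto simp: Legendre_def QuadRes_def split: if_splits)
  then have y: "p mod 5 = (y mod 5)\<^sup>2 mod 5" by (simp add: cong_def power_mod)
  have "y mod 5 \<in> {0..<5}" by simp
  then have "y mod 5 \<in> {0, 1, 2, 3, 4}" by (auto simp: atLeastLessThan_def)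
  with y np have "p mod 5 = 1 \<or> p mod 5 = 4" by (auto simp: cong_def)
  moreover have "odd p" using p prime_odd_int[of p] by simp
  ultimately show ?thesis by presburger
qed

text \<open>The pattern of most congruence proofs below: an explicit integer identity, matched
  against the last premise, supplies the coefficients.\<close>

lemma dvd_combine2: "m dvd u \<Longrightarrow> m dvd v \<Longrightarrow> w = r * u + s * v \<Longrightarrow> m dvd w" for m :: int
  by simp

lemma dvd_combine3:
  "m dvd u \<Longrightarrow> m dvd v \<Longrightarrow> m dvd v' \<Longrightarrow> w = r * u + s * v + t * v' \<Longrightarrow> m dvd w" for m :: int
  by simp

section \<open>The group SL(2,p) and its centre\<close>

locale sl2 =
  fixes p :: int and G (structure)
  assumes prime_p: "Factorial_Ring.prime p" and p_gt_5: "p > 5"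
  defines "G \<equiv> SL2 p"
begin

text \<open>Arbitrary integer entries turn matrix computations into integer identities; reduction
  modulo \<open>p\<close> matters only when matrices are compared.\<close>

definition mat :: "int \<Rightarrow> int \<Rightarrow> int \<Rightarrow> int \<Rightarrow> int \<times> int \<times> int \<times> int" where
  "mat a b c d = (a mod p, b mod p, c mod p, d mod p)"

fun tr :: "int \<times> int \<times> int \<times> int \<Rightarrow> int" where
  "tr (a, b, c, d) = (a + d) mod p"

definition Z :: "(int \<times> int \<times> int \<times> int) set" where
  "Z = {(1, 0, 0, 1), (p - 1, 0, 0, p - 1)}"

lemma p_dvd_mult_iff: "p dvd a * b \<longleftrightarrow> p dvd a \<or> p dvd b"
  using prime_p by (rule prime_dvd_mult_iff)

lemma small_not_dvd: "0 < n \<Longrightarrow> n \<le> 5 \<Longrightarrow> \<not> p dvd n"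
  using p_gt_5 zdvd_imp_le[of p n] by auto

lemma two_not_dvd: "\<not> p dvd 2" and four_not_dvd: "\<not> p dvd 4"
  using small_not_dvd[of 2] small_not_dvd[of 4] by auto

lemma inverse_mod: "\<not> p dvd a \<Longrightarrow> \<exists>b. p dvd a * b - 1"
  using prime_p prime_imp_coprime[of p a] cong_solve_coprime_int[of a p]
  by (auto simp: cong_iff_dvd_diff coprime_commute)

lemma mat_eq_iff: "mat a b c d = mat e f g h \<longleftrightarrow> p dvd a - e \<and> p dvd b - f \<and> p dvd c - g \<and> p dvd d - h"
  by (simp add: mat_def mod_eq_dvd_iff)

lemma mat_mult [simp]:
  "mat a b c d \<otimes> mat e f g h = mat (a * e + b * g) (a * f + b * h) (c * e + d * g) (c * f + d * h)"
  by (auto simp: G_def SL2_def mat_mult_mod_def mat_def intro!: mod_add_cong mod_mult_cong)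

lemma one_mat: "\<one> = mat 1 0 0 1"
  using p_gt_5 by (simp add: G_def SL2_def mat_def)

lemma tr_mat [simp]: "tr (mat a b c d) = (a + d) mod p"
  by (simp add: mat_def mod_simps)

lemma mod_one_iff: "x mod p = 1 \<longleftrightarrow> p dvd x - 1" for x :: int
  using p_gt_5 mod_eq_dvd_iff[of x p 1] by simp

lemma mat_carrier [simp]: "mat a b c d \<in> carrier G \<longleftrightarrow> p dvd a * d - b * c - 1"
proof -
  have "(a mod p * (d mod p) - b mod p * (c mod p)) mod p = (a * d - b * c) mod p"
    by (intro mod_diff_cong mod_mult_cong) simp_all
  moreover have "mat a b c d \<in> carrier G \<longleftrightarrow> (a mod p * (d mod p) - b mod p * (c mod p)) mod p = 1"
    using p_gt_5 by (simp add: G_def SL2_def SL2_carrier_def mat_def)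
  ultimately show ?thesis by (simp only: mod_one_iff)
qed

lemma carrier_cases:
  assumes "x \<in> carrier G"
  obtains a b c d where "x = mat a b c d" "p dvd a * d - b * c - 1"
proof -
  obtain a b c d where x: "x = (a, b, c, d)" by (cases x) auto
  with assms have "x = mat a b c d" 
    by (simp add: G_def SL2_def SL2_carrier_def mat_def)
  with that assms show thesis by (metis mat_carrier)
qed

lemma Z_eq: "Z = {mat 1 0 0 1, mat (-1) 0 0 (-1)}"
  using p_gt_5 by (simp add: Z_def mat_def zmod_minus1)

lemma det_mult:
  assumes "p dvd a * d - b * c - 1" "p dvd e * h - f * g - 1"
  shows "p dvd (a * e + b * g) * (c * f + d * h) - (a * f + b * h) * (c * e + d * g) - 1"
proof -
  have "(a * e + b * g) * (c * f + d * h) - (a * f + b * h) * (c * e + d * g) - 1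
     = (e * h - f * g) * (a * d - b * c - 1) + 1 * (e * h - f * g - 1)"
    by (simp add: algebra_simps)
  then show ?thesis by (rule dvd_combine2[OF assms])
qed

lemma group_G: "group G"
proof (rule groupI)
  fix x y assume "x \<in> carrier G" "y \<in> carrier G"
  then show "x \<otimes> y \<in> carrier G"
    by (elim carrier_cases) (simp add: det_mult)
next
  show "\<one> \<in> carrier G" by (simp add: one_mat)
next
  fix x y z assume "x \<in> carrier G" "y \<in> carrier G" "z \<in> carrier G"
  then show "x \<otimes> y \<otimes> z = x \<otimes> (y \<otimes> z)"
    by (elim carrier_cases) (simp add: algebra_simps)
next
  fix x assume "x \<in> carrier G"
  then show "\<one> \<otimes> x = x"
    by (elim carrier_cases) (simp add: one_mat)
next
  fix x assume "x \<in> carrier G"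
  then obtain a b c d where x: "x = mat a b c d" and det: "p dvd a * d - b * c - 1"
    by (rule carrier_cases)
  have "mat d (-b) (-c) a \<in> carrier G" "mat d (-b) (-c) a \<otimes> x = \<one>"
    using det by (simp_all add: x one_mat mat_eq_iff algebra_simps)
  then show "\<exists>y\<in>carrier G. y \<otimes> x = \<one>" by blast
qed

sublocale group G by (rule group_G)

lemma mat_inv:
  assumes "p dvd a * d - b * c - 1"
  shows "inv (mat a b c d) = mat d (-b) (-c) a"
  using assms by (intro inv_equality) (simp_all add: one_mat mat_eq_iff algebra_simps)

lemma finite_G: "finite (carrier G)"
proof (rule finite_subset)
  show "carrier G \<subseteq> {0..<p} \<times> {0..<p} \<times> {0..<p} \<times> {0..<p}"
    by (auto simp: G_def SL2_def SL2_carrier_def)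
qed auto

lemma mat_in_Z_iff:
  assumes "p dvd a * d - b * c - 1"
  shows "mat a b c d \<in> Z \<longleftrightarrow> p dvd b \<and> p dvd c \<and> p dvd a - d"
proof
  assume "mat a b c d \<in> Z"
  then show "p dvd b \<and> p dvd c \<and> p dvd a - d"
    using dvd_diff[of p "a - 1" "d - 1"] dvd_diff[of p "a + 1" "d + 1"]
    unfolding Z_eq by (auto simp: mat_eq_iff)
next
  assume *: "p dvd b \<and> p dvd c \<and> p dvd a - d"
  have "(a - 1) * (a + 1) = 1 * (a * d - b * c - 1) + a * (a - d) + c * b"
    by (simp add: algebra_simps)
  from dvd_combine3[OF assms _ _ this] * have "p dvd (a - 1) * (a + 1)" by blast
  then consider "p dvd a - 1" | "p dvd a + 1" by (auto simp: p_dvd_mult_iff)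
  then show "mat a b c d \<in> Z"
  proof cases
    case 1
    with * have "p dvd d - 1" using dvd_diff[of p "a - 1" "a - d"] by simp
    with 1 * show ?thesis by (simp add: Z_eq mat_eq_iff)
  next
    case 2
    with * have "p dvd d + 1" using dvd_diff[of p "a + 1" "a - d"] by (simp add: add.commute)
    with 2 * show ?thesis by (simp add: Z_eq mat_eq_iff)
  qed
qed

lemma Z_carrier: "Z \<subseteq> carrier G"
  by (auto simp: Z_eq)

lemma card_Z: "card Z = 2"
  using p_gt_5 by (simp add: Z_def)

lemma Z_central: "z \<in> Z \<Longrightarrow> x \<in> carrier G \<Longrightarrow> z \<otimes> x = x \<otimes> z"
  by (elim carrier_cases) (auto simp: Z_eq)

lemma Z_square: "z \<in> Z \<Longrightarrow> z \<otimes> z = \<one>"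
  by (auto simp: Z_eq one_mat)

lemma subgroup_Z: "subgroup Z G"
  by (rule subgroupI) (auto simp: Z_eq mat_inv)

lemma normal_Z: "Z \<lhd> G"
  unfolding normal_inv_iff
proof (intro conjI ballI subgroup_Z)
  fix x z assume "x \<in> carrier G" "z \<in> Z"
  then have "x \<otimes> z \<otimes> inv x = z"
    using Z_central[of z x, symmetric] Z_carrier by (auto simp: m_assoc)
  with \<open>z \<in> Z\<close> show "x \<otimes> z \<otimes> inv x \<in> Z" by simp
qed

text \<open>The three conditions are the minors of (b, c, a - d) and (f, g, e - h): matrices commute
  exactly when their trace-free parts are parallel.\<close>

lemma mat_commute_iff:
  "mat a b c d \<otimes> mat e f g h = mat e f g h \<otimes> mat a b c d \<longleftrightarrow>
     p dvd b * g - c * f \<and> p dvd (a - d) * f - b * (e - h) \<and> p dvd (a - d) * g - c * (e - h)"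
proof -
  have "p dvd a * e + b * g - (e * a + f * c) \<longleftrightarrow> p dvd b * g - c * f"
    by (rule arg_cong[where f = "\<lambda>n. p dvd n"]) (simp add: algebra_simps)
  moreover have "p dvd a * f + b * h - (e * b + f * d) \<longleftrightarrow> p dvd (a - d) * f - b * (e - h)"
    by (rule arg_cong[where f = "\<lambda>n. p dvd n"]) (simp add: algebra_simps)
  moreover have "p dvd c * e + d * g - (g * a + h * c) \<longleftrightarrow> p dvd -((a - d) * g - c * (e - h))"
    by (rule arg_cong[where f = "\<lambda>n. p dvd n"]) (simp add: algebra_simps)
  moreover have "p dvd c * f + d * h - (g * b + h * d) \<longleftrightarrow> p dvd -(b * g - c * f)"
    by (rule arg_cong[where f = "\<lambda>n. p dvd n"]) (simp add: algebra_simps)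
  ultimately show ?thesis unfolding mat_mult mat_eq_iff dvd_minus_iff by blast
qed

text \<open>Some coordinate of the first vector is invertible modulo \<open>p\<close>; the quotient
  of the two vectors in that coordinate is \<open>k\<close>.\<close>

lemma parallel_scale:
  assumes "\<not> (p dvd u1 \<and> p dvd u2 \<and> p dvd u3)"
    and "p dvd u1 * v2 - u2 * v1" "p dvd u3 * v1 - u1 * v3" "p dvd u3 * v2 - u2 * v3"
  obtains k where "[v1 = k * u1] (mod p)" "[v2 = k * u2] (mod p)" "[v3 = k * u3] (mod p)"
proof -
  have scale: "[v' = (r * v) * u'] (mod p)"
    if "p dvd u * r - 1" "p dvd u * v' - u' * v" for u v u' v' r
  proof -
    have "v' - (r * v) * u' = (-v') * (u * r - 1) + r * (u * v' - u' * v)"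
      by (simp add: algebra_simps)
    from dvd_combine2[OF that this] show ?thesis by (simp add: cong_iff_dvd_diff)
  qed
  have sc: "p dvd u' * v - u * v'" if "p dvd u * v' - u' * v" for u v u' v'
    using that by (metis dvd_minus_iff minus_diff_eq)
  have self: "p dvd u * v - u * v" for u v by simp
  consider "\<not> p dvd u1" | "\<not> p dvd u2" | "\<not> p dvd u3" using assms(1) by blast
  then show thesis
  proof cases
    case 1
    then obtain r where "p dvd u1 * r - 1" using inverse_mod by blast
    from scale[OF this self] scale[OF this assms(2)] scale[OF this sc[OF assms(3)]] show thesis by (rule that)
  next
    case 2
    then obtain r where "p dvd u2 * r - 1" using inverse_mod by blast
    from scale[OF this sc[OF assms(2)]] scale[OF this self] scale[OF this sc[OF assms(4)]] show thesis by (rule that)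
  next
    case 3
    then obtain r where "p dvd u3 * r - 1" using inverse_mod by blast
    from scale[OF this assms(3)] scale[OF this assms(4)] scale[OF this self] show thesis by (rule that)
  qed
qed

lemma noncentral_commute_scale:
  assumes det: "p dvd a * d - b * c - 1" and nc: "mat a b c d \<notin> Z"
    and "mat a b c d \<otimes> mat e f g h = mat e f g h \<otimes> mat a b c d"
  obtains k where "[f = k * b] (mod p)" "[g = k * c] (mod p)" "[e - h = k * (a - d)] (mod p)"
proof -
  have "\<not> (p dvd b \<and> p dvd c \<and> p dvd a - d)" using nc mat_in_Z_iff[OF det] by blast
  moreover have "p dvd b * g - c * f" "p dvd (a - d) * f - b * (e - h)" "p dvd (a - d) * g - c * (e - h)"
    using assms(3) unfolding mat_commute_iff by blast+
  ultimately show thesis by (rule parallel_scale) (rule that)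
qed

lemma centralizer_abelian:
  assumes x: "x \<in> carrier G" "x \<notin> Z" and y: "y \<in> carrier G" and z: "z \<in> carrier G"
    and xy: "x \<otimes> y = y \<otimes> x" and xz: "x \<otimes> z = z \<otimes> x"
  shows "y \<otimes> z = z \<otimes> y"
proof -
  obtain a b c d where x': "x = mat a b c d" "p dvd a * d - b * c - 1"
    using x(1) by (rule carrier_cases)
  obtain e f g h where y': "y = mat e f g h" using y by (rule carrier_cases)
  obtain e' f' g' h' where z': "z = mat e' f' g' h'" using z by (rule carrier_cases)
  obtain k where k: "[f = k * b] (mod p)" "[g = k * c] (mod p)" "[e - h = k * (a - d)] (mod p)"
    using noncentral_commute_scale[OF x'(2) x(2)[unfolded x'(1)] xy[unfolded x'(1) y']] .
  obtain l where l: "[f' = l * b] (mod p)" "[g' = l * c] (mod p)" "[e' - h' = l * (a - d)] (mod p)"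
    using noncentral_commute_scale[OF x'(2) x(2)[unfolded x'(1)] xz[unfolded x'(1) z']] .
  have "[f * g' - g * f' = (k * b) * (l * c) - (k * c) * (l * b)] (mod p)"
    "[(e - h) * f' - f * (e' - h') = (k * (a - d)) * (l * b) - (k * b) * (l * (a - d))] (mod p)"
    "[(e - h) * g' - g * (e' - h') = (k * (a - d)) * (l * c) - (k * c) * (l * (a - d))] (mod p)"
    by (intro cong_diff cong_mult k l)+
  then show ?thesis unfolding y' z' mat_commute_iff
    by (simp_all only: cong_dvd_iff) (simp add: algebra_simps)
qed

section \<open>Traces and parabolic elements\<close>

definition parabolic where
  "parabolic x \<longleftrightarrow> x \<in> carrier G \<and> x \<notin> Z \<and> p dvd (tr x)\<^sup>2 - 4"

lemma dvd_mod_square_iff: "p dvd (x mod p)\<^sup>2 - n \<longleftrightarrow> p dvd x\<^sup>2 - n" for x n :: int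
  by (metis mod_eq_dvd_iff power_mod)

lemma mat_parabolic_iff:
  assumes "p dvd a * d - b * c - 1"
  shows "parabolic (mat a b c d) \<longleftrightarrow> mat a b c d \<notin> Z \<and> p dvd (a + d)\<^sup>2 - 4"
  using assms by (simp add: parabolic_def dvd_mod_square_iff)

lemma tr_commute: "x \<in> carrier G \<Longrightarrow> y \<in> carrier G \<Longrightarrow> tr (x \<otimes> y) = tr (y \<otimes> x)"
  by (elim carrier_cases) (simp add: algebra_simps)

lemma tr_conj:
  assumes "x \<in> carrier G" "y \<in> carrier G"
  shows "tr (x \<otimes> y \<otimes> inv x) = tr y"
  using tr_commute[of "x \<otimes> y" "inv x"] assms by (simp add: m_assoc[symmetric])

lemma tr_inv: "x \<in> carrier G \<Longrightarrow> tr (inv x) = tr x"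
  by (elim carrier_cases) (simp add: mat_inv add.commute)

lemma conj_in_Z_iff:
  assumes "x \<in> carrier G" "y \<in> carrier G"
  shows "x \<otimes> y \<otimes> inv x \<in> Z \<longleftrightarrow> y \<in> Z"
proof
  assume "x \<otimes> y \<otimes> inv x \<in> Z"
  then have "inv x \<otimes> (x \<otimes> y \<otimes> inv x) \<otimes> inv (inv x) \<in> Z"
    using assms normal_Z unfolding normal_inv_iff by blast
  moreover have "inv x \<otimes> (x \<otimes> y \<otimes> inv x) \<otimes> inv (inv x) = y"
    using assms by (simp add: m_assoc inv_solve_left')
  ultimately show "y \<in> Z" by simp
next
  assume "y \<in> Z" then show "x \<otimes> y \<otimes> inv x \<in> Z"
    using assms normal_Z unfolding normal_inv_iff by blast
qed

lemma parabolic_conj: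
  assumes "x \<in> carrier G" "y \<in> carrier G"
  shows "parabolic (x \<otimes> y \<otimes> inv x) \<longleftrightarrow> parabolic y"
  using assms by (simp add: parabolic_def conj_in_Z_iff tr_conj)

lemma half:
  fixes x :: int
  assumes "p dvd 2 * x" shows "p dvd x"
  using assms two_not_dvd p_dvd_mult_iff by blast

text \<open>Commuting makes the trace-free part of \<open>y\<close> the \<open>k\<close>-fold of
  that of \<open>x\<close>, so the discriminant (squared trace minus 4) is multiplied by k^2. Equal
  traces and a nonzero discriminant leave k = 1 or k = -1, which give \<open>x\<close> and its
  inverse.\<close>

lemma commute_same_trace:
  assumes x: "x \<in> carrier G" "x \<notin> Z" "\<not> parabolic x" and y: "y \<in> carrier G"
    and xy: "x \<otimes> y = y \<otimes> x" and tr: "tr y = tr x"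
  shows "y = x \<or> y = inv x"
proof -
  obtain a b c d where x': "x = mat a b c d" "p dvd a * d - b * c - 1"
    using x(1) by (rule carrier_cases)
  obtain e f g h where y': "y = mat e f g h" "p dvd e * h - f * g - 1" using y by (rule carrier_cases)
  obtain k where k: "[f = k * b] (mod p)" "[g = k * c] (mod p)" "[e - h = k * (a - d)] (mod p)"
    using noncentral_commute_scale[OF x'(2) x(2)[unfolded x'(1)] xy[unfolded x'(1) y'(1)]] .
  have t: "p dvd (e + h) - (a + d)" using tr by (simp add: x' y' mod_eq_dvd_iff)
  have disc: "[(e - h)\<^sup>2 + 4 * (f * g) = (k * (a - d))\<^sup>2 + 4 * ((k * b) * (k * c))] (mod p)"
    by (intro cong_add cong_mult cong_pow k cong_refl)
  have 1: "p dvd ((e - h)\<^sup>2 + 4 * (f * g)) - k\<^sup>2 * ((a - d)\<^sup>2 + 4 * (b * c))"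
    using disc by (simp add: cong_iff_dvd_diff algebra_simps power2_eq_square)
  have "(k\<^sup>2 - 1) * ((a + d)\<^sup>2 - 4) =
     (-1) * (((e - h)\<^sup>2 + 4 * (f * g)) - k\<^sup>2 * ((a - d)\<^sup>2 + 4 * (b * c))) + 
     ((e + h) + (a + d)) * ((e + h) - (a + d)) +
     (4 * k\<^sup>2) * (a * d - b * c - 1) - 4 * (e * h - f * g - 1)"
    by (simp add: algebra_simps power2_eq_square)
  then have "p dvd (k\<^sup>2 - 1) * ((a + d)\<^sup>2 - 4)"
    using 1 t x'(2) y'(2) by (simp only: dvd_add dvd_diff dvd_mult)
  moreover have "\<not> p dvd (a + d)\<^sup>2 - 4"
    using x mat_parabolic_iff[OF x'(2)] unfolding x'(1) by blast
  ultimately have "p dvd k\<^sup>2 - 1" by (simp add: p_dvd_mult_iff)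
  moreover have "k\<^sup>2 - 1 = (k - 1) * (k + 1)" by (simp add: algebra_simps power2_eq_square)
  ultimately consider "[k = 1] (mod p)" | "[k = -1] (mod p)"
    by (auto simp: p_dvd_mult_iff cong_iff_dvd_diff)
  then show ?thesis
  proof cases
    case 1
    have "[k * u = u] (mod p)" for u using cong_mult[OF 1 cong_refl[of u]] by simp
    with k have s: "p dvd f - b" "p dvd g - c" "p dvd (e - h) - (a - d)"
      by (meson cong_trans cong_iff_dvd_diff)+
    have "2 * (e - a) = 1 * ((e - h) - (a - d)) + 1 * ((e + h) - (a + d))"
         "2 * (h - d) = (-1) * ((e - h) - (a - d)) + 1 * ((e + h) - (a + d))" by simp_all
    from this[THEN dvd_combine2[OF s(3) t]] have "p dvd e - a" "p dvd h - d" by (auto intro: half)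
    with s show ?thesis by (simp add: x' y' mat_eq_iff)
  next
    case 2
    have "[k * u = - u] (mod p)" for u using cong_mult[OF 2 cong_refl[of u]] by simp
    with k have s: "p dvd f - (- b)" "p dvd g - (- c)" "p dvd (e - h) - (-(a - d))"
      by (meson cong_trans cong_iff_dvd_diff)+
    have "2 * (e - d) = 1 * ((e - h) - (-(a - d))) + 1 * ((e + h) - (a + d))"
         "2 * (h - a) = (-1) * ((e - h) - (-(a - d))) + 1 * ((e + h) - (a + d))" by simp_all
    from this[THEN dvd_combine2[OF s(3) t]] have "p dvd e - d" "p dvd h - a" by (auto intro: half)
    with s show ?thesis by (simp add: x'(1) y'(1) mat_inv[OF x'(2)] mat_eq_iff)
  qed
qed

text \<open>The only element of order 2 is -1: if the square of \<open>x\<close> is 1, then the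
  trace annihilates the trace-free part, and trace 0 would make the square -1.\<close>

lemma square_one_in_Z:
  assumes x: "x \<in> carrier G" and sq: "x \<otimes> x = \<one>"
  shows "x \<in> Z"
proof -
  obtain a b c d where x': "x = mat a b c d" "p dvd a * d - b * c - 1"
    using x(1) by (rule carrier_cases)
  have s: "p dvd a * a + b * c - 1" "p dvd a * b + b * d" "p dvd c * a + d * c" "p dvd c * b + d * d - 1"
    using sq by (simp_all add: x' one_mat mat_eq_iff)
  have "p dvd (a + d) * b" "p dvd (a + d) * c" using s by (simp_all add: algebra_simps)
  moreover have "(a + d) * (a - d) = 1 * (a * a + b * c - 1) + (-1) * (c * b + d * d - 1)"
    by (simp add: algebra_simps)
  from dvd_combine2[OF s(1) s(4) this] have "p dvd (a + d) * (a - d)" .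
  moreover have "\<not> p dvd a + d"
  proof
    assume *: "p dvd a + d"
    have "2 = a * (a + d) + (-1) * (a * a + b * c - 1) + (-1) * (a * d - b * c - 1)"
      by (simp add: algebra_simps)
    from dvd_combine3[OF * s(1) x'(2) this] show False using two_not_dvd by blast
  qed
  ultimately show ?thesis using mat_in_Z_iff[OF x'(2)] by (auto simp: x' p_dvd_mult_iff)
qed

text \<open>Conjugates by the upper and the lower elementary matrix suffice: if \<open>x\<close>
  commuted with both, its off-diagonal entries and the difference of its diagonal entries would
  vanish.\<close>

lemma noncentral_conj_not_commute:
  assumes x: "x \<in> carrier G" "x \<notin> Z"
  shows "\<exists>y\<in>carrier G. (y \<otimes> x \<otimes> inv y) \<otimes> x \<noteq> x \<otimes> (y \<otimes> x \<otimes> inv y)"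
proof (rule ccontr)
  assume "\<not> ?thesis"
  then have *: "(y \<otimes> x \<otimes> inv y) \<otimes> x = x \<otimes> (y \<otimes> x \<otimes> inv y)" if "y \<in> carrier G" for y
    using that by blast
  obtain a b c d where x': "x = mat a b c d" "p dvd a * d - b * c - 1"
    using x(1) by (rule carrier_cases)
  have U: "mat 1 1 0 1 \<in> carrier G" and V: "mat 1 0 1 1 \<in> carrier G" by simp_all
  have "mat 1 1 0 1 \<otimes> x \<otimes> inv (mat 1 1 0 1) = mat (a + c) (b + d - a - c) c (d - c)"
    by (simp add: mat_inv x' algebra_simps)
  from *[OF U, unfolded this, unfolded x' mat_commute_iff]
  have u: "p dvd (b + d - a - c) * c - c * b" "p dvd (a + c - (d - c)) * c - c * (a - d)"
    "p dvd (a + c - (d - c)) * b - (b + d - a - c) * (a - d)"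
    by simp_all
  have "mat 1 0 1 1 \<otimes> x \<otimes> inv (mat 1 0 1 1) = mat (a - b) b (a - b + c - d) (b + d)"
    by (simp add: mat_inv x' algebra_simps)
  from *[OF V, unfolded this, unfolded x' mat_commute_iff]
  have v: "p dvd (a - b - (b + d)) * b - b * (a - d)" by simp_all
  have "p dvd 2 * (c * c)" using u(2) by (simp add: algebra_simps)
  then have c: "p dvd c" using half by (auto simp: p_dvd_mult_iff)
  have "p dvd 2 * (- (b * b))" using v by (simp add: algebra_simps)
  then have b: "p dvd b" using half[of "- (b * b)"] by (auto simp: p_dvd_mult_iff)
  have "(a - d) * (a - d) = 1 * ((a + c - (d - c)) * b - (b + d - a - c) * (a - d)) 
      + (- 2 * b - (a - d)) * c + 0 * b"
    by (simp add: algebra_simps)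
  from dvd_combine3[OF u(3) c b this] have "p dvd a - d" by (simp add: p_dvd_mult_iff)
  with b c x(2) mat_in_Z_iff[OF x'(2)] show False by (simp add: x')
qed

text \<open>Once the lower left entry of an element is nonzero, conjugating makes its upper left entry zero,
  and a commutator with diag(2, 1/2) is then lower triangular with diagonal (4, 1/4); here
  the condition p > 5 ensures that 4 and 1/4 differ.\<close>
lemma normal_contains_parabolic:
  assumes H: "H \<lhd> G" and x: "x \<in> H" "x \<notin> Z"
  shows "\<exists>u\<in>H. parabolic u"
proof -
  have sub: "subgroup H G" and conj: "\<And>y h. y \<in> carrier G \<Longrightarrow> h \<in> H \<Longrightarrow> y \<otimes> h \<otimes> inv y \<in> H"
    using H unfolding normal_inv_iff by auto
  have comm: "y \<otimes> h \<otimes> inv y \<otimes> inv h \<in> H" if "y \<in> carrier G" "h \<in> H" for y h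
    using that by (intro subgroup.m_closed[OF sub] conj subgroup.m_inv_closed[OF sub])
  have comm': "h \<otimes> y \<otimes> inv h \<otimes> inv y \<in> H" if "y \<in> carrier G" "h \<in> H" for y h
  proof -
    have "h \<otimes> (y \<otimes> inv h \<otimes> inv y) \<in> H"
      using that by (intro subgroup.m_closed[OF sub] conj subgroup.m_inv_closed[OF sub])
    moreover have "h \<in> carrier G" using subgroup.mem_carrier[OF sub that(2)] .
    ultimately show ?thesis using that by (simp only: m_assoc inv_closed m_closed)
  qed
  obtain a b c d where abcd: "mat a b c d \<in> H" "p dvd a * d - b * c - 1" "\<not> p dvd c"
  proof -
    obtain a b c d where x': "x = mat a b c d" "p dvd a * d - b * c - 1"
      using carrier_cases[OF subgroup.mem_carrier[OF sub x(1)]] .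
    consider "\<not> p dvd c" | "\<not> p dvd b" | "p dvd b" "p dvd c" "\<not> p dvd a - d"
      using x(2) mat_in_Z_iff[OF x'(2)] by (auto simp: x')
    then show thesis
    proof cases
      case 1 with x x' that show thesis by blast
    next
      case 2
      have "mat 0 (-1) 1 0 \<otimes> x \<otimes> inv (mat 0 (-1) 1 0) = mat d (-c) (-b) a"
        by (simp add: mat_inv x')
      moreover have "mat 0 (-1) 1 0 \<otimes> x \<otimes> inv (mat 0 (-1) 1 0) \<in> H" using x conj by simp
      ultimately show thesis using that[of d "-c" "-b" a] 2 x'(2) by (simp add: algebra_simps)
    next
      case 3
      \<comment> \<open>For a diagonal matrix this conjugation moves the difference of the diagonal
        entries into the lower left corner.\<close>
      have "mat 1 0 1 1 \<otimes> x \<otimes> inv (mat 1 0 1 1) = mat (a - b) b (a - b + c - d) (b + d)"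
        by (simp add: mat_inv x' algebra_simps)
      moreover have "mat 1 0 1 1 \<otimes> x \<otimes> inv (mat 1 0 1 1) \<in> H" using x conj by simp
      moreover have "\<not> p dvd a - b + c - d"
      proof
        assume "p dvd a - b + c - d"
        from dvd_combine3[OF this 3(1) 3(2), of "a - d" 1 1 "-1"] 3(3) show False by simp
      qed
      moreover have "p dvd (a - b) * (b + d) - b * (a - b + c - d) - 1"
        using x'(2) by (simp add: algebra_simps)
      ultimately show thesis using that by metis
    qed
  qed
  obtain k where k: "p dvd c * k - 1" using inverse_mod[OF abcd(3)] by blast
  define s t where "s = - (a * k)" and "t = a + d"
  have "mat 1 s 0 1 \<otimes> mat a b c d \<otimes> inv (mat 1 s 0 1) = mat (a + s * c) (b + s * d - s * (a + s * c)) c (d - s * c)"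
    by (simp add: mat_inv algebra_simps)
  also have "\<dots> = mat 0 (-k) c t"
  proof -
    have "a + s * c - 0 = (-a) * (c * k - 1) + 0 * (a * d - b * c - 1)"
      "b + s * d - s * (a + s * c) - (- k) = (- b - a * a * k) * (c * k - 1) + (- k) * (a * d - b * c - 1)"
      "d - s * c - t = a * (c * k - 1) + 0 * (a * d - b * c - 1)"
      by (simp_all add: s_def t_def algebra_simps)
    from this[THEN dvd_combine2[OF k abcd(2)]] show ?thesis by (simp add: mat_eq_iff)
  qed
  finally have y: "mat 0 (-k) c t \<in> H" using conj[of "mat 1 s 0 1", OF _ abcd(1)] by simp
  obtain w where w: "p dvd 2 * w - 1" using inverse_mod[OF two_not_dvd] by blast
  have w': "p dvd 2 * w - 0 * 0 - 1" and k': "p dvd 0 * t - (-k) * c - 1"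
    using w k by (simp_all add: mult.commute)
  have D: "mat 2 0 0 w \<in> carrier G" using w by simp
  define e where "e = w * w * c * t - t * c"
  have "mat 2 0 0 w \<otimes> mat 0 (-k) c t \<otimes> inv (mat 2 0 0 w) \<otimes> inv (mat 0 (-k) c t)
      = mat (4 * k * c) 0 (w * w * c * t - 2 * w * t * c) (w * w * c * k)"
    by (simp add: mat_inv[OF w'] mat_inv[OF k'] algebra_simps)
  also have "\<dots> = mat 4 0 e (w * w)"
  proof -
    have "4 * k * c - 4 = 4 * (c * k - 1) + 0 * (2 * w - 1)"
      "w * w * c * t - 2 * w * t * c - e = 0 * (c * k - 1) + (- t * c) * (2 * w - 1)"
      "w * w * c * k - w * w = (w * w) * (c * k - 1) + 0 * (2 * w - 1)"
      by (simp_all add: e_def algebra_simps)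
    from this[THEN dvd_combine2[OF k w]] show ?thesis by (simp add: mat_eq_iff)
  qed
  finally have L: "mat 4 0 e (w * w) \<in> H" using comm[OF D y] by simp
  have "4 * (w * w) - 1 = (2 * w + 1) * (2 * w - 1)" by (simp add: algebra_simps)
  then have w4: "p dvd 4 * (w * w) - 1" using w by simp
  then have w4': "p dvd 4 * (w * w) - 0 * e - 1" by simp
  \<comment> \<open>A second commutator, now with a lower elementary matrix, is unipotent. As
    \<open>w\<close> stands for 1/2, its lower left entry is 1/16 - 1 = -15/16, nonzero because
    \<open>p\<close> divides neither 3 nor 5.\<close>
  have "mat 4 0 e (w * w) \<otimes> mat 1 0 1 1 \<otimes> inv (mat 4 0 e (w * w)) \<otimes> inv (mat 1 0 1 1)
      = mat (4 * (w * w)) 0 (w * w * (w * w) - 4 * (w * w)) (4 * (w * w))"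
    by (simp add: mat_inv[OF w4'] mat_inv[of 1 1 0 1] algebra_simps)
  also have "\<dots> = mat 1 0 (w * w * (w * w) - 1) 1"
    using w4 dvd_minus_iff[of p "4 * (w * w) - 1"] by (simp add: mat_eq_iff)
  finally have P: "mat 1 0 (w * w * (w * w) - 1) 1 \<in> H" using comm'[OF _ L, of "mat 1 0 1 1"] by simp
  have "\<not> p dvd w * w * (w * w) - 1"
  proof
    assume *: "p dvd w * w * (w * w) - 1"
    have "3 * 5 = (-16) * (w * w * (w * w) - 1) + (4 * (w * w) + 1) * (4 * (w * w) - 1)"
      by (simp add: algebra_simps)
    from dvd_combine2[OF * w4 this] have "p dvd 3 \<or> p dvd 5" by (simp only: p_dvd_mult_iff)
    then show False using small_not_dvd[of 3] small_not_dvd[of 5] by simp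
  qed
  then have "parabolic (mat 1 0 (w * w * (w * w) - 1) 1)"
    by (simp add: mat_parabolic_iff mat_in_Z_iff)
  with P show ?thesis by blast
qed

subsection \<open>Borel subgroups\<close>

lemma inverting_proper:
  assumes "x \<in> carrier G" "x \<notin> Z"
  shows "inverting x \<noteq> carrier G"
proof
  assume *: "inverting x = carrier G"
  obtain y where y: "y \<in> carrier G" "(y \<otimes> x \<otimes> inv y) \<otimes> x \<noteq> x \<otimes> (y \<otimes> x \<otimes> inv y)"
    using noncentral_conj_not_commute[OF assms] by blast
  then have "y \<otimes> x \<otimes> inv y = x \<or> y \<otimes> x \<otimes> inv y = inv x"
    using * by (auto simp: inverting_def)
  with y(2) assms(1) show False by auto
qed

text \<open>The tested component is the lower left entry: this is the stabilizer of the line through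
  the first basis vector.\<close>

definition borel where
  "borel = {x \<in> carrier G. fst (snd (snd x)) = 0}"

lemma mat_borel_iff: "mat a b c d \<in> borel \<longleftrightarrow> p dvd a * d - b * c - 1 \<and> p dvd c"
  by (simp add: borel_def mat_carrier) (simp add: mat_def dvd_eq_mod_eq_0)

lemma borel_cases:
  assumes "x \<in> borel"
  obtains a b d where "x = mat a b 0 d" "p dvd a * d - 1"
proof -
  obtain a b c d where x: "x = mat a b c d" "p dvd a * d - b * c - 1"
    using assms carrier_cases[of x thesis] unfolding borel_def by auto
  then have c: "p dvd c" using assms by (simp add: mat_borel_iff)
  have "a * d - 1 = 1 * (a * d - b * c - 1) + b * c" by simp
  from dvd_combine2[OF x(2) c this] c x(1) that[of a b d] show thesis by (simp add: mat_eq_iff)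
qed

lemma subgroup_borel: "subgroup borel G"
proof (rule subgroupI)
  show "borel \<subseteq> carrier G" by (auto simp: borel_def)
  have "\<one> \<in> borel" by (simp add: one_mat mat_borel_iff)
  then show "borel \<noteq> {}" by blast
next
  fix x assume "x \<in> borel"
  then show "inv x \<in> borel"
    by (elim borel_cases) (simp add: mat_inv mat_borel_iff mult.commute)
next
  fix x y assume "x \<in> borel" and "y \<in> borel"
  obtain a b d where x: "x = mat a b 0 d" "p dvd a * d - 1" using \<open>x \<in> borel\<close> by (rule borel_cases)
  obtain e f h where y: "y = mat e f 0 h" "p dvd e * h - 1" using \<open>y \<in> borel\<close> by (rule borel_cases)
  have "(a * e) * (d * h) - 1 = (e * h) * (a * d - 1) + 1 * (e * h - 1)"
    by (simp add: algebra_simps)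
  from dvd_combine2[OF x(2) y(2) this] show "x \<otimes> y \<in> borel" by (simp add: x(1) y(1) mat_borel_iff)
qed

text \<open>The stabilizer of the line spanned by the first column of \<open>y\<close>. Points of
  the projective line are thus represented by group elements, up to right factors in
  \<open>borel\<close>.\<close>

definition borel_at where
  "borel_at y = {x \<in> carrier G. inv y \<otimes> x \<otimes> y \<in> borel}"

lemma subgroup_borel_at: "y \<in> carrier G \<Longrightarrow> subgroup (borel_at y) G"
  using subgroup_conj_preimage[OF subgroup_borel, of "inv y"] by (simp add: borel_at_def)

lemma borel_at_proper:
  assumes y: "y \<in> carrier G"
  shows "borel_at y \<noteq> carrier G"
proof
  assume *: "borel_at y = carrier G"
  have V: "mat 1 0 1 1 \<in> carrier G" by simp
  then have "y \<otimes> mat 1 0 1 1 \<otimes> inv y \<in> borel_at y" using y * by simp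
  then have "mat 1 0 1 1 \<in> borel" using y V unfolding borel_at_def by (simp add: conj_cancel)
  then show False using small_not_dvd[of 1] by (simp add: mat_borel_iff)
qed

lemma borel_at_subset:
  assumes x: "x \<in> carrier G" and y: "y \<in> carrier G" and xy: "inv x \<otimes> y \<in> borel"
  shows "borel_at x \<subseteq> borel_at y"
proof
  fix g assume "g \<in> borel_at x"
  then have g: "g \<in> carrier G" "inv x \<otimes> g \<otimes> x \<in> borel" by (auto simp: borel_at_def)
  have "inv (inv x \<otimes> y) \<otimes> (inv x \<otimes> g \<otimes> x) \<otimes> (inv x \<otimes> y) \<in> borel"
    by (rule subgroup.m_closed[OF subgroup_borel subgroup.m_closed[OF subgroup_borel
          subgroup.m_inv_closed[OF subgroup_borel xy] g(2)] xy])
  also have "inv (inv x \<otimes> y) \<otimes> (inv x \<otimes> g \<otimes> x) \<otimes> (inv x \<otimes> y) = inv y \<otimes> g \<otimes> y"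
    using x y g(1) by (simp add: inv_mult_group m_assoc inv_mult_cancel)
  finally show "g \<in> borel_at y" using g by (simp add: borel_at_def)
qed

lemma borel_at_eq:
  assumes "x \<in> carrier G" "y \<in> carrier G" "inv x \<otimes> y \<in> borel"
  shows "borel_at x = borel_at y"
proof -
  have "inv (inv x \<otimes> y) \<in> borel" using assms subgroup.m_inv_closed[OF subgroup_borel] by blast
  then have "inv y \<otimes> x \<in> borel" using assms by (simp add: inv_mult_group)
  with assms borel_at_subset show ?thesis by blast
qed

text \<open>The quadratic form is the determinant of the vector (v1, v2) together with its image;
  its zeros are the fixed points of the matrix.\<close>

lemma mat_borel_at_iff:
  assumes det: "p dvd a * d - b * c - 1" and det': "p dvd v1 * s - r * v2 - 1"
  shows "mat a b c d \<in> borel_at (mat v1 r v2 s) \<longleftrightarrow> p dvd c * (v1 * v1) + (d - a) * (v1 * v2) + (- b) * (v2 * v2)"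
proof -
  have "inv (mat v1 r v2 s) \<otimes> mat a b c d \<otimes> mat v1 r v2 s \<in> carrier G"
    using det det' by simp
  then show ?thesis using det det'
    by (simp add: borel_at_def mat_inv[OF det'] mat_borel_iff) (simp add: algebra_simps)
qed

lemma mat_inv_mult_borel_iff:
  assumes "p dvd v1 * s - r * v2 - 1" "p dvd w1 * s' - r' * w2 - 1"
  shows "inv (mat v1 r v2 s) \<otimes> mat w1 r' w2 s' \<in> borel \<longleftrightarrow> p dvd v1 * w2 - v2 * w1"
proof -
  have "inv (mat v1 r v2 s) \<otimes> mat w1 r' w2 s' \<in> carrier G"
    using assms by simp
  then show ?thesis by (simp add: mat_inv[OF assms(1)] mat_borel_iff)
qed

text \<open>A binary quadratic form with two different zeros is determined up to a factor: the
  right-hand sides are \<open>k\<close> times the coefficients of the product of v2 X - v1 Y and w2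
  X - w1 Y.\<close>

lemma quadratic_roots:
  assumes v: "p dvd A * (v1 * v1) + B * (v1 * v2) + C * (v2 * v2)"
    and w: "p dvd A * (w1 * w1) + B * (w1 * w2) + C * (w2 * w2)"
    and vw: "\<not> p dvd v1 * w2 - v2 * w1"
  obtains k where "[A = k * (v2 * w2)] (mod p)" "[B = k * (- (v1 * w2 + v2 * w1))] (mod p)"
    "[C = k * (v1 * w1)] (mod p)"
proof -
  let ?q = "A * (v1 * v1) + B * (v1 * v2) + C * (v2 * v2)"
  let ?r = "A * (w1 * w1) + B * (w1 * w2) + C * (w2 * w2)"
  let ?D = "v1 * w2 - v2 * w1"
  have nz: "\<not> (p dvd v2 * w2 \<and> p dvd - (v1 * w2 + v2 * w1) \<and> p dvd v1 * w1)"
  proof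
    assume *: "p dvd v2 * w2 \<and> p dvd - (v1 * w2 + v2 * w1) \<and> p dvd v1 * w1"
    \<comment> \<open>The discriminant of that product is the square of \<open>?D\<close>, so its
      coefficients cannot all vanish.\<close>
    have D: "?D * ?D = (- (v1 * w2 + v2 * w1)) * (- (v1 * w2 + v2 * w1)) + (- 4 * v1 * w1) * (v2 * w2)"
      by (simp add: algebra_simps)
    have "p dvd ?D * ?D" by (rule dvd_combine2[OF _ _ D]) (use * in blast)+
    with vw show False unfolding p_dvd_mult_iff by blast
  qed
  have c: "?D * ((v2 * w2) * B - (- (v1 * w2 + v2 * w1)) * A) = (w2 * w2) * ?q + (- (v2 * v2)) * ?r"
    "?D * (v1 * w1 * A - v2 * w2 * C) = (w1 * w2) * ?q + (- (v1 * v2)) * ?r"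
    "?D * (v1 * w1 * B - (- (v1 * w2 + v2 * w1)) * C) = (- w1 * w1) * ?q + (v1 * v1) * ?r"
    by (simp_all add: algebra_simps)
  from c[THEN dvd_combine2[OF v w]] have
    "p dvd (v2 * w2) * B - (- (v1 * w2 + v2 * w1)) * A"
    "p dvd v1 * w1 * A - v2 * w2 * C"
    "p dvd v1 * w1 * B - (- (v1 * w2 + v2 * w1)) * C"
    using vw by (simp_all only: p_dvd_mult_iff) blast+
  with nz show thesis by (rule parallel_scale) (rule that)
qed

text \<open>Elements that fix the same two points have proportional fixed-point forms, hence
  parallel trace-free parts.\<close>

lemma borel_at_commute:
  assumes x: "x \<in> carrier G" and y: "y \<in> carrier G" and xy: "inv x \<otimes> y \<notin> borel"
    and g: "g \<in> borel_at x" "g \<in> borel_at y" and h: "h \<in> borel_at x" "h \<in> borel_at y"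
  shows "g \<otimes> h = h \<otimes> g"
proof -
  obtain v1 r v2 s where x': "x = mat v1 r v2 s" "p dvd v1 * s - r * v2 - 1" using x by (rule carrier_cases)
  obtain w1 r' w2 s' where y': "y = mat w1 r' w2 s'" "p dvd w1 * s' - r' * w2 - 1" using y by (rule carrier_cases)
  have D: "\<not> p dvd v1 * w2 - v2 * w1" using xy unfolding x'(1) y'(1) mat_inv_mult_borel_iff[OF x'(2) y'(2)] .
  have gh: "g \<in> carrier G" "h \<in> carrier G" using g h by (auto simp: borel_at_def)
  obtain a b c d where g': "g = mat a b c d" "p dvd a * d - b * c - 1" using gh(1) by (rule carrier_cases)
  obtain a' b' c' d' where h': "h = mat a' b' c' d'" "p dvd a' * d' - b' * c' - 1" using gh(2) by (rule carrier_cases)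
  obtain k where k: "[c = k * (v2 * w2)] (mod p)" "[d - a = k * (- (v1 * w2 + v2 * w1))] (mod p)"
    "[- b = k * (v1 * w1)] (mod p)"
    using g unfolding g'(1) x' y' mat_borel_at_iff[OF g'(2) x'(2)] mat_borel_at_iff[OF g'(2) y'(2)]
    by (rule quadratic_roots[OF _ _ D])
  obtain l where l: "[c' = l * (v2 * w2)] (mod p)" "[d' - a' = l * (- (v1 * w2 + v2 * w1))] (mod p)"
    "[- b' = l * (v1 * w1)] (mod p)"
    using h unfolding h'(1) x' y' mat_borel_at_iff[OF h'(2) x'(2)] mat_borel_at_iff[OF h'(2) y'(2)]
    by (rule quadratic_roots[OF _ _ D])
  have "[- b * c' - c * (- b') = k * (v1 * w1) * (l * (v2 * w2)) - k * (v2 * w2) * (l * (v1 * w1))] (mod p)"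
    "[(d - a) * (- b') - (- b) * (d' - a') = k * (- (v1 * w2 + v2 * w1)) * (l * (v1 * w1)) - k * (v1 * w1) * (l * (- (v1 * w2 + v2 * w1)))] (mod p)"
    "[(d - a) * c' - c * (d' - a') = k * (- (v1 * w2 + v2 * w1)) * (l * (v2 * w2)) - k * (v2 * w2) * (l * (- (v1 * w2 + v2 * w1)))] (mod p)"
    by (intro cong_diff cong_mult k l)+
  moreover have "k * u * (l * t) - k * t * (l * u) = 0" for u t by simp
  ultimately have "p dvd - b * c' - c * (- b')" "p dvd (d - a) * (- b') - (- b) * (d' - a')"
    "p dvd (d - a) * c' - c * (d' - a')" by (simp_all only: cong_0_iff)
  moreover have "b * c' - c * b' = - (- b * c' - c * (- b'))" 
    "(a - d) * b' - b * (a' - d') = (d - a) * (- b') - (- b) * (d' - a')"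
    "(a - d) * c' - c * (a' - d') = - ((d - a) * c' - c * (d' - a'))"
    by (simp_all add: algebra_simps)
  ultimately show ?thesis unfolding g' h' mat_commute_iff by (simp only: dvd_minus_iff)
qed

text \<open>At a third point the product of the two linear forms is nonzero, so the factor
  \<open>k\<close> vanishes and with it the trace-free part.\<close>

lemma three_borels_central:
  assumes x: "x \<in> carrier G" and y: "y \<in> carrier G" and z: "z \<in> carrier G"
    and xy: "inv x \<otimes> y \<notin> borel" and xz: "inv x \<otimes> z \<notin> borel" and yz: "inv y \<otimes> z \<notin> borel"
    and g: "g \<in> borel_at x" "g \<in> borel_at y" "g \<in> borel_at z"
  shows "g \<in> Z"
proof -
  obtain v1 r v2 s where x': "x = mat v1 r v2 s" "p dvd v1 * s - r * v2 - 1" using x by (rule carrier_cases)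
  obtain w1 r' w2 s' where y': "y = mat w1 r' w2 s'" "p dvd w1 * s' - r' * w2 - 1" using y by (rule carrier_cases)
  obtain z1 r'' z2 s'' where z': "z = mat z1 r'' z2 s''" "p dvd z1 * s'' - r'' * z2 - 1" using z by (rule carrier_cases)
  have D: "\<not> p dvd v1 * w2 - v2 * w1" using xy unfolding x'(1) y'(1) mat_inv_mult_borel_iff[OF x'(2) y'(2)] .
  have Dz: "\<not> p dvd v1 * z2 - v2 * z1" using xz unfolding x'(1) z'(1) mat_inv_mult_borel_iff[OF x'(2) z'(2)] .
  have Dz': "\<not> p dvd w1 * z2 - w2 * z1" using yz unfolding y'(1) z'(1) mat_inv_mult_borel_iff[OF y'(2) z'(2)] .
  have g0: "g \<in> carrier G" using g by (auto simp: borel_at_def)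
  obtain a b c d where g': "g = mat a b c d" "p dvd a * d - b * c - 1" using g0 by (rule carrier_cases)
  obtain k where k: "[c = k * (v2 * w2)] (mod p)" "[d - a = k * (- (v1 * w2 + v2 * w1))] (mod p)"
    "[- b = k * (v1 * w1)] (mod p)"
    using g(1,2) unfolding g'(1) x' y' mat_borel_at_iff[OF g'(2) x'(2)] mat_borel_at_iff[OF g'(2) y'(2)]
    by (rule quadratic_roots[OF _ _ D])
  have "[c * (z1 * z1) + (d - a) * (z1 * z2) + (- b) * (z2 * z2) = 
     k * (v2 * w2) * (z1 * z1) + k * (- (v1 * w2 + v2 * w1)) * (z1 * z2) + k * (v1 * w1) * (z2 * z2)] (mod p)"
    by (intro cong_add cong_mult cong_refl k)
  then have "p dvd k * (v2 * w2) * (z1 * z1) + k * (- (v1 * w2 + v2 * w1)) * (z1 * z2) + k * (v1 * w1) * (z2 * z2)"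
    using g(3) cong_dvd_iff unfolding g'(1) z'(1) mat_borel_at_iff[OF g'(2) z'(2)] by blast
  also have "k * (v2 * w2) * (z1 * z1) + k * (- (v1 * w2 + v2 * w1)) * (z1 * z2) + k * (v1 * w1) * (z2 * z2)
    = k * ((v1 * z2 - v2 * z1) * (w1 * z2 - w2 * z1))"
    by (simp add: algebra_simps)
  finally have "p dvd k" using Dz Dz' by (simp add: p_dvd_mult_iff)
  with k have "p dvd c" "p dvd d - a" "p dvd - b" by (metis cong_dvd_iff dvd_mult2)+
  then show ?thesis using mat_in_Z_iff[OF g'(2)] dvd_minus_iff[of p "d - a"] by (simp add: g'(1))
qed

section \<open>Commutators in a Borel subgroup\<close>

lemma borel_commutator_trace:
  assumes "x \<in> borel" "y \<in> borel"
  shows "tr (x \<otimes> y \<otimes> inv x \<otimes> inv y) = 2"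
proof -
  obtain a b d where x: "x = mat a b 0 d" "p dvd a * d - 1" using assms(1) by (rule borel_cases)
  obtain e f h where y: "y = mat e f 0 h" "p dvd e * h - 1" using assms(2) by (rule borel_cases)
  have "inv x = mat d (-b) 0 a" "inv y = mat h (-f) 0 e"
    using mat_inv[of a d b 0] mat_inv[of e h f 0] x y by simp_all
  then have "tr (x \<otimes> y \<otimes> inv x \<otimes> inv y) = (2 * (a * d) * (e * h)) mod p"
    by (simp add: x(1) y(1) algebra_simps)
  also have "\<dots> = 2 mod p"
  proof -
    have "2 * (a * d) * (e * h) - 2 = (2 * (e * h)) * (a * d - 1) + 2 * (e * h - 1)"
      by (simp add: algebra_simps)
    from dvd_combine2[OF x(2) y(2) this] show ?thesis by (simp add: mod_eq_dvd_iff)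
  qed
  finally show ?thesis using p_gt_5 by simp
qed

lemma borel_at_commutator_trace:
  assumes y: "y \<in> carrier G" and g: "g \<in> borel_at y" and h: "h \<in> borel_at y"
  shows "tr (g \<otimes> h \<otimes> inv g \<otimes> inv h) = 2"
proof -
  have gh: "g \<in> carrier G" "h \<in> carrier G" using g h by (auto simp: borel_at_def)
  let ?c = "\<lambda>x. inv y \<otimes> x \<otimes> inv (inv y)"
  have "tr (g \<otimes> h \<otimes> inv g \<otimes> inv h) = tr (?c (g \<otimes> h \<otimes> inv g \<otimes> inv h))"
    using y gh by (subst tr_conj) auto
  also have "?c (g \<otimes> h \<otimes> inv g \<otimes> inv h) = ?c g \<otimes> ?c h \<otimes> inv (?c g) \<otimes> inv (?c h)"
    using y gh by (simp only: conj_mult conj_inv inv_closed m_closed)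
  also have "tr \<dots> = 2" using g h y by (intro borel_commutator_trace) (auto simp: borel_at_def)
  finally show ?thesis .
qed

lemma tr_eq_2_one:
  assumes "x \<in> carrier G" "\<not> parabolic x" "tr x = 2"
  shows "x = \<one>"
proof -
  have "x \<in> Z" using assms by (auto simp: parabolic_def)
  moreover have "x \<noteq> mat (-1) 0 0 (-1)"
  proof
    assume "x = mat (-1) 0 0 (-1)"
    with assms(3) have "(-2) mod p = 2 mod p" using p_gt_5 by simp
    then show False using four_not_dvd by (simp add: mod_eq_dvd_iff)
  qed
  ultimately show ?thesis by (auto simp: Z_eq one_mat)
qed

lemma commutator_one_imp_commute:
  assumes "x \<in> carrier G" "y \<in> carrier G" "x \<otimes> y \<otimes> inv x \<otimes> inv y = \<one>"
  shows "x \<otimes> y = y \<otimes> x"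
  using assms by (metis inv_solve_right' l_one m_closed one_closed inv_closed)

text \<open>A commutator of elements fixing a common point has trace 2; in the absence of parabolic
  elements it can only be the identity.\<close>

lemma borel_at_nonparabolic_commute:
  assumes H: "subgroup H G" and np: "\<And>u. u \<in> H \<Longrightarrow> \<not> parabolic u" and y: "y \<in> carrier G"
    and g: "g \<in> borel_at y" "g \<in> H" and h: "h \<in> borel_at y" "h \<in> H"
  shows "g \<otimes> h = h \<otimes> g"
proof (rule commutator_one_imp_commute)
  show gh: "g \<in> carrier G" "h \<in> carrier G" using g h by (auto simp: borel_at_def)
  have "g \<otimes> h \<otimes> inv g \<otimes> inv h \<in> H"
    using g(2) h(2) H by (intro subgroup.m_closed[OF H] subgroup.m_inv_closed[OF H])
  with gh borel_at_commutator_trace[OF y g(1) h(1)] np show "g \<otimes> h \<otimes> inv g \<otimes> inv h = \<one>"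
    by (intro tr_eq_2_one) auto
qed

lemma tr_square:
  assumes "x \<in> carrier G" shows "p dvd tr (x \<otimes> x) - ((tr x)\<^sup>2 - 2)"
proof -
  obtain a b c d where x: "x = mat a b c d" "p dvd a * d - b * c - 1" using assms by (rule carrier_cases)
  have "(a * a + b * c + (c * b + d * d)) - ((a + d)\<^sup>2 - 2) = (-2) * (a * d - b * c - 1) + 0 * 0"
    by (simp add: algebra_simps power2_eq_square)
  from dvd_combine2[OF x(2) dvd_0_right this]
  have "[a * a + b * c + (c * b + d * d) = (a + d)\<^sup>2 - 2] (mod p)" by (simp add: cong_iff_dvd_diff)
  moreover have "[tr (x \<otimes> x) = a * a + b * c + (c * b + d * d)] (mod p)"
    "[(tr x)\<^sup>2 - 2 = (a + d)\<^sup>2 - 2] (mod p)"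
    by (simp_all add: x(1)) (intro cong_diff cong_pow; simp)
  ultimately show ?thesis by (meson cong_iff_dvd_diff cong_sym cong_trans)
qed

text \<open>If \<open>h\<close> inverted \<open>g\<close>, their commutator would be the square of
  \<open>inv g\<close>. Having trace 2, it would make the squared trace of \<open>g\<close> equal to
  4.\<close>

lemma inverting_borel_at_commute:
  assumes y: "y \<in> carrier G" and g: "g \<in> borel_at y" "g \<notin> Z" "\<not> parabolic g"
    and h: "h \<in> borel_at y" "h \<in> inverting g"
  shows "h \<otimes> g = g \<otimes> h"
proof -
  have gh: "g \<in> carrier G" "h \<in> carrier G" using g h by (auto simp: borel_at_def)
  have "h \<otimes> g \<otimes> inv h \<noteq> inv g"
  proof
    assume *: "h \<otimes> g \<otimes> inv h = inv g"
    have "tr (inv g \<otimes> inv g) = 2" using borel_at_commutator_trace[OF y h(1) g(1)] by (simp add: *)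
    then have "p dvd 4 - (tr g)\<^sup>2" using tr_square[OF inv_closed[OF gh(1)]] by (simp add: tr_inv[OF gh(1)])
    then have "p dvd (tr g)\<^sup>2 - 4" by (metis dvd_minus_iff minus_diff_eq)
    with g gh show False by (simp add: parabolic_def)
  qed
  then have "h \<otimes> g \<otimes> inv h = g" using h(2) by (auto simp: inverting_def)
  then show ?thesis using gh by (simp add: commute_iff_conj)
qed

subsection \<open>Generation\<close>

lemma unipotent_pow: "mat 1 t 0 1 [^] n = mat 1 (int n * t) 0 1"
  by (induction n) (simp_all add: one_mat algebra_simps)

lemma lower_unipotent_pow: "mat 1 0 t 1 [^] n = mat 1 0 (int n * t) 1"
  by (induction n) (simp_all add: one_mat algebra_simps)

lemma multiple_mod:
  assumes "\<not> p dvd t"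
  obtains n where "p dvd int n * t - s"
proof -
  obtain r where r: "p dvd t * r - 1" using inverse_mod[OF assms] by blast
  have n: "int (nat (r * s mod p)) = r * s mod p" using p_gt_5 by simp
  have "[r * s mod p * t = r * s * t] (mod p)" by (intro cong_mult) auto
  moreover have "r * s * t - s = s * (t * r - 1) + 0 * 0" by (simp add: algebra_simps)
  from dvd_combine2[OF r dvd_0_right this] have "[r * s * t = s] (mod p)"
    by (simp add: cong_iff_dvd_diff)
  ultimately have "[r * s mod p * t = s] (mod p)" by (rule cong_trans)
  with that[of "nat (r * s mod p)"] n show thesis by (simp add: cong_iff_dvd_diff)
qed

text \<open>The powers of one transvection are all the upper ones, an element outside
  \<open>borel\<close> then yields the lower ones, and both kinds together generate SL(2,p).\<close>

lemma unipotent_generates: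
  assumes H: "subgroup H G" and t: "mat 1 t 0 1 \<in> H" "\<not> p dvd t"
    and y: "y \<in> H" "y \<notin> borel"
  shows "H = carrier G"
proof
  show "H \<subseteq> carrier G" using H by (rule subgroup.subset)
  have pow: "x \<in> H \<Longrightarrow> x [^] n \<in> H" for x and n :: nat
    using H by (induction n) (auto simp: subgroup.one_closed subgroup.m_closed)
  have U: "mat 1 s 0 1 \<in> H" for s
  proof -
    obtain n where "p dvd int n * t - s" using multiple_mod[OF t(2)] .
    then have "mat 1 s 0 1 = mat 1 t 0 1 [^] n"
      by (simp add: unipotent_pow mat_eq_iff) (metis dvd_minus_iff minus_diff_eq)
    with pow[OF t(1)] show ?thesis by simp
  qed
  note m_closed' = subgroup.m_closed[OF H]
  obtain a b c d where y': "y = mat a b c d" "p dvd a * d - b * c - 1"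
    using y(1) subgroup.mem_carrier[OF H] carrier_cases[of y thesis] by blast
  have c: "\<not> p dvd c" using y(2) y'(2) by (simp add: y'(1) mat_borel_iff)
  obtain r where r: "p dvd c * r - 1" using inverse_mod[OF c] by blast
  \<comment> \<open>\<open>k\<close> makes the upper left entry 1, \<open>l\<close> then clears the
    upper right one, and the determinant settles the last entry.\<close>
  define k where "k = r * (1 - a)"
  define l where "l = - (b + k * d)"
  have "mat 1 k 0 1 \<otimes> mat a b c d \<otimes> mat 1 l 0 1 = mat (a + k * c) ((a + k * c) * l + (b + k * d)) c (c * l + d)"
    by simp
  also have "\<dots> = mat 1 0 c 1"
  proof -
    have "a + k * c - 1 = (1 - a) * (c * r - 1) + 0 * (a * d - b * c - 1)"
      "(a + k * c) * l + (b + k * d) - 0 = (l * (1 - a)) * (c * r - 1) + 0 * (a * d - b * c - 1)"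
      "c * l + d - 1 = (d * a - d) * (c * r - 1) + 1 * (a * d - b * c - 1)"
      by (simp_all add: k_def l_def algebra_simps)
    from this[THEN dvd_combine2[OF r y'(2)]] show ?thesis by (simp add: mat_eq_iff)
  qed
  finally have "mat 1 0 c 1 \<in> H" using m_closed'[OF m_closed'[OF U y(1)] U, of k l] by (simp add: y'(1))
  then have V: "mat 1 0 s 1 \<in> H" for s
  proof -
    obtain n where "p dvd int n * c - s" using multiple_mod[OF c] .
    then have "mat 1 0 s 1 = mat 1 0 c 1 [^] n"
      by (simp add: lower_unipotent_pow mat_eq_iff) (metis dvd_minus_iff minus_diff_eq)
    with pow[OF \<open>mat 1 0 c 1 \<in> H\<close>] show ?thesis by simp
  qed
  \<comment> \<open>A nonzero lower left entry permits a factorization into upper, lower and upper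
    transvections.\<close>
  have big: "mat e f g h \<in> H" if det: "p dvd e * h - f * g - 1" and g: "\<not> p dvd g" for e f g h
  proof -
    obtain r where r: "p dvd g * r - 1" using inverse_mod[OF g] by blast
    let ?k = "(e - 1) * r" and ?l = "(h - 1) * r"
    have "mat 1 ?k 0 1 \<otimes> mat 1 0 g 1 \<otimes> mat 1 ?l 0 1 = mat (1 + ?k * g) ((1 + ?k * g) * ?l + ?k) g (g * ?l + 1)"
      by simp
    also have "\<dots> = mat e f g h"
    proof -
      have "1 + ?k * g - e = (e - 1) * (g * r - 1) + 0 * (e * h - f * g - 1)"
        "(1 + ?k * g) * ?l + ?k - f = ((e - 1) * (h - 1) * r + f) * (g * r - 1) + r * (e * h - f * g - 1)"
        "g * ?l + 1 - h = (h - 1) * (g * r - 1) + 0 * (e * h - f * g - 1)"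
        by (simp_all add: algebra_simps)
      from this[THEN dvd_combine2[OF r det]] show ?thesis by (simp add: mat_eq_iff)
    qed
    finally show ?thesis using m_closed'[OF m_closed'[OF U V] U] by metis
  qed
  show "carrier G \<subseteq> H"
  proof
    fix x assume "x \<in> carrier G"
    then obtain e f g h where x: "x = mat e f g h" and det: "p dvd e * h - f * g - 1" by (rule carrier_cases)
    show "x \<in> H"
    proof (cases "p dvd g")
      case False with big det x show ?thesis by blast
    next
      case True
      have "\<not> p dvd e"
      proof
        assume *: "p dvd e"
        have "1 = h * e + (- f) * g + (-1) * (e * h - f * g - 1)" by (simp add: algebra_simps)
        from dvd_combine3[OF * True det this] show False using small_not_dvd[of 1] by simp
      qed
      \<comment> \<open>Adding the first row to the second makes the lower left entry
        nonzero.\<close>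
      then have "\<not> p dvd e + g" using True by (simp add: dvd_add_left_iff)
      moreover have "p dvd e * (f + h) - f * (e + g) - 1" using det by (simp add: algebra_simps)
      ultimately have "mat e f (e + g) (f + h) \<in> H" using big by blast
      then have "mat 1 0 (-1) 1 \<otimes> mat e f (e + g) (f + h) \<in> H" using V m_closed' by blast
      then show ?thesis by (simp add: x)
    qed
  qed
qed

lemma parabolic_borel_unipotent:
  assumes u: "parabolic u" "u \<in> borel"
  obtains z t where "z \<in> Z" "z \<otimes> u = mat 1 t 0 1" "\<not> p dvd t"
proof -
  obtain a b d where u': "u = mat a b 0 d" "p dvd a * d - 1" using u(2) by (rule borel_cases)
  have det: "p dvd a * d - b * 0 - 1" using u'(2) by simp
  have par: "u \<notin> Z" "p dvd (a + d)\<^sup>2 - 4" using u(1) mat_parabolic_iff[OF det] by (simp_all add: u'(1))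
  have "(a - d) * (a - d) = 1 * ((a + d)\<^sup>2 - 4) + (-4) * (a * d - 1)"
    by (simp add: algebra_simps power2_eq_square)
  from dvd_combine2[OF par(2) u'(2) this] have ad: "p dvd a - d" by (simp add: p_dvd_mult_iff)
  have b: "\<not> p dvd b" using par(1) mat_in_Z_iff[OF det] ad by (simp add: u'(1))
  have "(a - 1) * (a + 1) = 1 * (a * d - 1) + a * (a - d)" by (simp add: algebra_simps)
  from dvd_combine2[OF u'(2) ad this] consider "p dvd a - 1" | "p dvd a + 1" by (auto simp: p_dvd_mult_iff)
  then show thesis
  proof cases
    case 1
    then have "p dvd d - 1" using dvd_diff[OF 1 ad] by simp
    with 1 have "mat 1 0 0 1 \<otimes> u = mat 1 b 0 1" by (simp add: u'(1) mat_eq_iff)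
    with b that[of "mat 1 0 0 1" b] show thesis by (simp add: Z_eq)
  next
    case 2
    then have "p dvd d + 1" using dvd_diff[OF 2 ad] by (simp add: add.commute)
    then have "mat (-1) 0 0 (-1) \<otimes> u = mat 1 (- b) 0 1" using 2 dvd_minus_iff[of p "a + 1"] dvd_minus_iff[of p "d + 1"]
      by (simp add: u'(1) mat_eq_iff)
    with b that[of "mat (-1) 0 0 (-1)" "-b"] show thesis by (simp add: Z_eq)
  qed
qed

lemma parabolic_fixes_line:
  assumes "parabolic u"
  obtains y where "y \<in> carrier G" "u \<in> borel_at y"
proof -
  have "u \<in> carrier G" using assms by (simp add: parabolic_def)
  then obtain a b c d where u: "u = mat a b c d" and det: "p dvd a * d - b * c - 1" by (rule carrier_cases)
  have par: "p dvd (a + d)\<^sup>2 - 4" using assms mat_parabolic_iff[OF det] by (simp add: u)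
  show thesis
  proof (cases "p dvd c")
    case True
    then have "u \<in> borel_at (mat 1 0 0 1)"
      using det by (simp add: u mat_borel_at_iff)
    then show thesis by (rule that[rotated]) simp
  next
    case False
    obtain r where r: "p dvd c * r - 1" using inverse_mod[OF False] by blast
    obtain w where w: "p dvd 2 * w - 1" using inverse_mod[OF two_not_dvd] by blast
    \<comment> \<open>The discriminant (a - d)^2 + 4bc of the fixed-point form is the squared trace
      minus 4, hence zero, and ((a - d)/2, c) spans the double root. The second column chosen below
      completes the determinant to 1.\<close>
    let ?h = "w * (a - d)"
    have det': "p dvd ?h * 0 - (- r) * c - 1" using r by (simp add: mult.commute)
    have h: "p dvd 2 * ?h - (a - d)" 
    proof -
      have "2 * ?h - (a - d) = (a - d) * (2 * w - 1) + 0 * 0" by (simp add: algebra_simps)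
      from dvd_combine2[OF w dvd_0_right this] show ?thesis .
    qed
    let ?q = "c * (?h * ?h) + (d - a) * (?h * c) + (- b) * (c * c)"
    have "2 * (2 * ?q) = (c * (2 * ?h - (a - d))) * (2 * ?h - (a - d)) + (- c) * ((a + d)\<^sup>2 - 4) + (4 * c) * (a * d - b * c - 1)"
      by (simp add: algebra_simps power2_eq_square)
    from dvd_combine3[OF h par det this] have "p dvd ?q" using half by blast
    then have "u \<in> borel_at (mat ?h (-r) c 0)" unfolding u mat_borel_at_iff[OF det det'] .
    moreover have "mat ?h (-r) c 0 \<in> carrier G" using det' by simp
    ultimately show thesis using that by blast
  qed
qed

text \<open>Conjugation by \<open>y\<close> makes the fixed line standard, and
  \<open>Z \<subseteq> H\<close> allows the sign change that turns the parabolic element into a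
  transvection. Any element outside \<open>borel\<close> would then generate the whole group with
  it.\<close>

lemma parabolic_subgroup_borel:
  assumes H: "subgroup H G" "Z \<subseteq> H" "H \<noteq> carrier G" and u: "u \<in> H" "parabolic u"
    and y: "y \<in> carrier G" "u \<in> borel_at y"
  shows "H \<subseteq> borel_at y"
proof -
  let ?K = "{x \<in> carrier G. y \<otimes> x \<otimes> inv y \<in> H}"
  have K: "subgroup ?K G" using H(1) y(1) by (rule subgroup_conj_preimage)
  have uc: "u \<in> carrier G" and ub: "inv y \<otimes> u \<otimes> y \<in> borel" using y(2) by (auto simp: borel_at_def)
  have uK: "inv y \<otimes> u \<otimes> y \<in> ?K" using u(1) y(1) uc by (simp add: conj_cancel)
  have "parabolic (inv y \<otimes> u \<otimes> y)" using parabolic_conj[of "inv y" u] y(1) uc u(2) by simp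
  then obtain z t where z: "z \<in> Z" "z \<otimes> (inv y \<otimes> u \<otimes> y) = mat 1 t 0 1" "\<not> p dvd t"
    using parabolic_borel_unipotent[OF _ ub] by metis
  have "z \<in> ?K" using z(1) H(2) Z_carrier y(1) normal_Z unfolding normal_inv_iff by auto
  from subgroup.m_closed[OF K this uK] have t: "mat 1 t 0 1 \<in> ?K" by (simp only: z(2))
  have "?K \<subseteq> borel"
  proof (rule ccontr)
    assume "\<not> ?K \<subseteq> borel"
    then obtain x where "x \<in> ?K" "x \<notin> borel" by blast
    from unipotent_generates[OF K t z(3) this] have *: "?K = carrier G" .
    have "carrier G \<subseteq> H"
    proof
      fix x assume x: "x \<in> carrier G"
      then have "inv y \<otimes> x \<otimes> y \<in> ?K" unfolding * using y(1) by simp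
      with x y(1) show "x \<in> H" by (simp add: conj_cancel)
    qed
    with H(3) subgroup.subset[OF H(1)] show False by blast
  qed
  show ?thesis
  proof
    fix x assume x: "x \<in> H"
    then have xc: "x \<in> carrier G" using subgroup.mem_carrier[OF H(1)] by blast
    then have "inv y \<otimes> x \<otimes> y \<in> ?K" using x y(1) by (simp add: conj_cancel)
    then show "x \<in> borel_at y" using \<open>?K \<subseteq> borel\<close> xc by (auto simp: borel_at_def)
  qed
qed

lemma pow_five_in_Z:
  assumes y: "y \<in> carrier G" "y \<notin> Z" and y5: "y \<otimes> y \<otimes> y \<otimes> y \<otimes> y \<in> Z"
  shows "p mod 10 = 1 \<or> p mod 10 = 9"
proof -
  obtain a b c d where y': "y = mat a b c d" and det: "p dvd a * d - b * c - 1" using y(1) by (rule carrier_cases)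
  define D where "D = a * d - b * c"
  \<comment> \<open>By Cayley-Hamilton the trace-free part of a power of \<open>y\<close> is a
    multiple of that of \<open>y\<close>; for the fifth power this is the factor, in terms of trace
    and determinant.\<close>
  define F where "F = (a + d)^4 - 3 * (a + d)\<^sup>2 * D + D\<^sup>2"
  have "\<exists>e f g h. y \<otimes> y \<otimes> y \<otimes> y \<otimes> y = mat e f g h \<and> f = b * F \<and> g = c * F \<and> e - h = (a - d) * F"
    unfolding y' mat_mult F_def D_def
    by (intro exI conjI, rule refl) (simp_all add: power4_eq_xxxx power2_eq_square algebra_simps)
  then obtain e f g h where m: "y \<otimes> y \<otimes> y \<otimes> y \<otimes> y = mat e f g h" "f = b * F" "g = c * F" "e - h = (a - d) * F"
    by blast
  have "mat e f g h \<in> carrier G" using y(1) by (simp flip: m(1))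
  then have "p dvd f \<and> p dvd g \<and> p dvd e - h" using y5 mat_in_Z_iff[of e h f g] by (simp add: m(1))
  moreover have "\<not> (p dvd b \<and> p dvd c \<and> p dvd a - d)" using y(2) mat_in_Z_iff[OF det] by (simp add: y')
  ultimately have F: "p dvd F" unfolding m p_dvd_mult_iff by blast
  let ?T = "a + d"
  have D: "p dvd D - 1" using det by (simp add: D_def)
  \<comment> \<open>For determinant 1, T^4 - 3T^2 + 1 splits into T^2 - T - 1 and T^2 + T - 1;
    completing the square in either brings in 5.\<close>
  have "((2 * ?T - 1)\<^sup>2 - 5) * ((2 * ?T + 1)\<^sup>2 - 5) = 16 * F + (48 * ?T\<^sup>2 - 16 * (D + 1)) * (D - 1)"
    unfolding F_def by (simp add: power4_eq_xxxx power2_eq_square algebra_simps)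
  from dvd_combine2[OF F D this] consider "p dvd (2 * ?T - 1)\<^sup>2 - 5" | "p dvd (2 * ?T + 1)\<^sup>2 - 5"
    by (auto simp: p_dvd_mult_iff)
  then show ?thesis using five_square_mod_10 prime_p p_gt_5 by cases blast+
qed

section \<open>Involutions and generation by three of them\<close>

lemma norm_form_represents_minus_one: "\<exists>a b. p dvd a * a + a * b + b * b + 1"
proof -
  have odd: "odd p" using prime_p p_gt_5 prime_odd_int[of p] by simp
  let ?S = "{0..(p - 1) div 2}"
  \<comment> \<open>Completing the square, 4(a^2 + ab + b^2 + 1) = x^2 + 3y^2 + 4 with x = 2a + b
    and y = b. Squares and numbers -4 - 3y^2 each take (p + 1)/2 values modulo \<open>p\<close>, so
    some value is common.\<close>
  let ?f = "\<lambda>x. (x * x) mod p" and ?g = "\<lambda>x. (- 4 - 3 * (x * x)) mod p"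
  have inj_sq: "x = y" if xy: "x \<in> ?S" "y \<in> ?S" and *: "p dvd x * x - y * y" for x y
  proof -
    have "x * x - y * y = (x - y) * (x + y)" by (simp add: algebra_simps)
    with * consider "p dvd x - y" | "p dvd x + y" by (auto simp: p_dvd_mult_iff)
    then show ?thesis
    proof cases
      case 1
      then show ?thesis using xy zdvd_imp_le[of p "x - y"] zdvd_imp_le[of p "y - x"] dvd_minus_iff[of p "x - y"]
        by (cases x y rule: linorder_cases) auto
    next
      case 2
      then show ?thesis using xy zdvd_imp_le[of p "x + y"] by (cases "x + y > 0") auto
    qed
  qed
  have "inj_on ?f ?S" by (rule inj_onI) (auto simp: mod_eq_dvd_iff intro: inj_sq)
  moreover have "inj_on ?g ?S"
  proof (rule inj_onI)
    fix x y assume xy: "x \<in> ?S" "y \<in> ?S" and "?g x = ?g y"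
    then have "p dvd 3 * (y * y - x * x)" by (simp add: mod_eq_dvd_iff algebra_simps)
    then have "p dvd y * y - x * x" using small_not_dvd[of 3] unfolding p_dvd_mult_iff by simp
    with inj_sq xy show "x = y" by blast
  qed
  moreover obtain q where q: "p = 2 * q + 1" using odd by (rule oddE)
  then have "card ?S = nat (q + 1)" by simp
  ultimately have "card (?f ` ?S) + card (?g ` ?S) = nat (p + 1)"
    using q p_gt_5 by (simp add: card_image)
  moreover have "card (?f ` ?S \<union> ?g ` ?S) \<le> card {0..<p}"
    using p_gt_5 by (intro card_mono) auto
  moreover have "nat (p + 1) > card {0..<p}" using p_gt_5 by simp
  ultimately have "?f ` ?S \<inter> ?g ` ?S \<noteq> {}"
    using card_Un_disjoint[of "?f ` ?S" "?g ` ?S"] by fastforce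
  then obtain x y where "x * x mod p = (- 4 - 3 * (y * y)) mod p" by auto
  then have xy: "p dvd x * x + 4 + 3 * (y * y)" by (simp add: mod_eq_dvd_iff algebra_simps)
  obtain w where w: "p dvd 2 * w - 1" using inverse_mod[OF two_not_dvd] by blast
  let ?a = "w * (x - y)"
  have "2 * (2 * (?a * ?a + ?a * y + y * y + 1)) = ((x - y) * (2 * ?a + x + y)) * (2 * w - 1) + 1 * (x * x + 4 + 3 * (y * y))"
    by (simp add: algebra_simps)
  from dvd_combine2[OF w xy this] have "p dvd ?a * ?a + ?a * y + y * y + 1" using half by blast
  then show ?thesis by blast
qed

lemma commuting_in_inverting:
  assumes "x \<in> carrier G" "y \<in> carrier G" "y \<otimes> x = x \<otimes> y"
  shows "y \<in> inverting x"
  using assms commute_iff_conj[OF assms(1,2)] by (simp add: inverting_def)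

lemma Z_subset_inverting: "x \<in> carrier G \<Longrightarrow> Z \<subseteq> inverting x"
  using Z_carrier commuting_in_inverting Z_central by blast

text \<open>Trace 0 characterizes the lifts of involutions of PSL(2,p); the square is given by
  Cayley-Hamilton.\<close>

lemma trace_zero_square:
  assumes "x \<in> carrier G" "tr x = 0"
  shows "x \<otimes> x = mat (-1) 0 0 (-1)"
proof -
  obtain a b c d where x: "x = mat a b c d" and det: "p dvd a * d - b * c - 1" using assms(1) by (rule carrier_cases)
  have t: "p dvd a + d" using assms(2) by (simp add: x dvd_eq_mod_eq_0)
  have "a * a + b * c - (-1) = a * (a + d) + (-1) * (a * d - b * c - 1)"
    "a * b + b * d - 0 = b * (a + d) + 0 * (a * d - b * c - 1)"
    "c * a + d * c - 0 = c * (a + d) + 0 * (a * d - b * c - 1)"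
    "c * b + d * d - (-1) = d * (a + d) + (-1) * (a * d - b * c - 1)"
    by (simp_all add: algebra_simps)
  from this[THEN dvd_combine2[OF t det]] show ?thesis unfolding x mat_mult mat_eq_iff by blast
qed

text \<open>Both elements invert their product, as in a dihedral group. If the product is central,
  they commute and \<open>inverting x\<close> serves instead.\<close>

lemma trace_zero_pair_proper:
  assumes x: "x \<in> carrier G" "tr x = 0" and y: "y \<in> carrier G" "tr y = 0"
  obtains K where "subgroup K G" "Z \<subseteq> K" "x \<in> K" "y \<in> K" "K \<noteq> carrier G"
proof -
  let ?m = "mat (-1) 0 0 (-1)"
  have m: "?m \<in> carrier G" "?m \<in> Z" by (simp_all add: Z_eq)
  have xx: "x \<otimes> x = ?m" and yy: "y \<otimes> y = ?m" using x y trace_zero_square by auto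
  have inv: "inv u = ?m \<otimes> u" if "u \<in> carrier G" "u \<otimes> u = ?m" for u
    using that m Z_square[OF m(2)] by (intro inv_equality) (simp_all add: m_assoc)
  let ?w = "x \<otimes> y"
  have w: "?w \<in> carrier G" using x y by simp
  show thesis
  proof (cases "?w \<in> Z")
    case False
    have winv: "inv ?w = y \<otimes> x"
    proof -
      have "inv ?w = (?m \<otimes> y) \<otimes> (?m \<otimes> x)" using x y xx yy by (simp add: inv_mult_group inv)
      also have "\<dots> = (?m \<otimes> ?m) \<otimes> (y \<otimes> x)"
        using x(1) y(1) m Z_central[OF m(2) y(1)] by (metis m_assoc m_closed)
      finally show ?thesis using x y Z_square[OF m(2)] by simp
    qed
    have "x \<otimes> ?w \<otimes> inv x = inv ?w"
    proof -
      have "x \<otimes> ?w \<otimes> inv x = (?m \<otimes> y) \<otimes> inv x" using x y by (simp add: m_assoc[symmetric] xx)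
      also have "\<dots> = inv ?w" using inv[OF y(1) yy] x y by (simp add: inv_mult_group)
      finally show ?thesis .
    qed
    moreover have "y \<otimes> ?w \<otimes> inv y = inv ?w" unfolding winv using x y by (simp add: m_assoc)
    ultimately have "x \<in> inverting ?w" "y \<in> inverting ?w" using x y by (simp_all add: inverting_def)
    then show thesis using that[of "inverting ?w"] subgroup_inverting Z_subset_inverting inverting_proper False w
      by blast
  next
    case True
    have "x \<notin> Z"
    proof
      assume "x \<in> Z"
      then have "2 mod p = 0 \<or> (-2) mod p = 0" using x(2) by (auto simp: Z_eq)
      then show False using two_not_dvd by (auto simp: dvd_eq_mod_eq_0[symmetric])
    qed
    moreover have "y \<otimes> x = x \<otimes> y"
    proof -
      have "x \<otimes> (y \<otimes> x) = x \<otimes> (x \<otimes> y)" using Z_central[OF True x(1)] x y by (simp add: m_assoc)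
      then show ?thesis using x y by simp
    qed
    then have "x \<in> inverting x" "y \<in> inverting x" using x y by (simp_all add: commuting_in_inverting)
    ultimately show thesis using that[of "inverting x"] subgroup_inverting Z_subset_inverting inverting_proper x
      by blast
  qed
qed

text \<open>The three involutions are chosen so that their product is the transvection with upper right entry 1.\<close>
lemma three_trace_zero_generators:
  obtains x y z where "x \<in> carrier G" "y \<in> carrier G" "z \<in> carrier G" "tr x = 0" "tr y = 0" "tr z = 0"
    "\<And>H. subgroup H G \<Longrightarrow> x \<in> H \<Longrightarrow> y \<in> H \<Longrightarrow> z \<in> H \<Longrightarrow> H = carrier G"
proof -
  obtain a b where ab: "p dvd a * a + a * b + b * b + 1" using norm_form_represents_minus_one by blast
  \<comment> \<open>\<open>?x\<close> and \<open>?y\<close> have determinant -(a^2 + ab + b^2), so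
    the norm form has to take the value -1.\<close>
  let ?x = "mat (-b) (a + b) a b" and ?y = "mat a b (a + b) (-a)" and ?z = "mat 0 (-1) 1 0"
  have m: "p dvd - (a * a + a * b + b * b + 1)" using ab by (simp only: dvd_minus_iff)
  have "(- b) * b - (a + b) * a - 1 = - (a * a + a * b + b * b + 1)"
    "a * (- a) - b * (a + b) - 1 = - (a * a + a * b + b * b + 1)"
    by (simp_all add: algebra_simps)
  with m have "?x \<in> carrier G" "?y \<in> carrier G" by (simp_all only: mat_carrier)
  moreover have "?z \<in> carrier G" by simp
  moreover have "H = carrier G" if H: "subgroup H G" "?x \<in> H" "?y \<in> H" "?z \<in> H" for H
  proof (rule unipotent_generates[OF H(1)])
    have "?x \<otimes> ?y \<otimes> ?z \<in> H" using subgroup.m_closed[OF H(1)] H by blast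
    also have "?x \<otimes> ?y \<otimes> ?z = mat 1 1 0 1"
    proof -
      have "((- b) * a + (a + b) * (a + b)) * 0 + ((- b) * b + (a + b) * (- a)) * 1 - 1 = - (a * a + a * b + b * b + 1)"
        "((- b) * a + (a + b) * (a + b)) * (-1) + ((- b) * b + (a + b) * (- a)) * 0 - 1 = - (a * a + a * b + b * b + 1)"
        "(a * a + b * (a + b)) * 0 + (a * b + b * (- a)) * 1 - 0 = 0"
        "(a * a + b * (a + b)) * (-1) + (a * b + b * (- a)) * 0 - 1 = - (a * a + a * b + b * b + 1)"
        by (simp_all add: algebra_simps)
      with m show ?thesis by (simp only: mat_mult mat_eq_iff dvd_0_right simp_thms)
    qed
    finally show "mat 1 1 0 1 \<in> H" .
    show "\<not> p dvd 1" using small_not_dvd[of 1] by simp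
    then show "?z \<notin> borel" by (simp add: mat_borel_iff)
  qed (rule H(4))
  ultimately show thesis by (intro that[of ?x ?y ?z]) simp_all
qed

section \<open>Proper subgroups with a common element\<close>

text \<open>Turns the order of a centralizer, twice its order modulo \<open>Z\<close>, into an
  exponent modulo \<open>Z\<close>.\<close>

lemma even_pow_one_in_Z:
  fixes n :: nat
  assumes x: "x \<in> carrier G" and n: "x [^] (2 * n) = \<one>"
  shows "x [^] n \<in> Z"
proof (rule square_one_in_Z)
  show "x [^] n \<otimes> x [^] n = \<one>" using n x by (simp add: nat_pow_mult mult_2)
qed (use x in simp)

lemma pow_Z:
  fixes m n k :: nat
  assumes x: "x \<in> carrier G" and Z: "x [^] m \<in> Z" "x [^] n \<in> Z" and k: "m = n + k"
  shows "x [^] k \<in> Z"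
proof -
  have "inv (x [^] n) \<otimes> (x [^] n \<otimes> x [^] k) \<in> Z"
    using Z x unfolding k nat_pow_mult[OF x]
    by (intro subgroup.m_closed[OF subgroup_Z] subgroup.m_inv_closed[OF subgroup_Z])
  then show ?thesis using x by (simp add: inv_mult_cancel)
qed

text \<open>Lagrange's theorem in the centralizer of \<open>g\<close> turns the orders 6, 8 and 10
  into the exponents 3, 4 and 5. The combination of 6 with a group of order 120 enters through an
  element whose fifth power is central.\<close>

lemma exceptional_cases:
  assumes H: "subgroup H G" "Z \<subseteq> H" and np: "\<And>u. u \<in> H \<Longrightarrow> \<not> parabolic u"
    and g: "g \<in> H" "g \<notin> Z" "g \<otimes> g \<notin> Z" and exc: "\<not> H \<subseteq> inverting g"
  shows "g [^] (3::nat) \<in> Z \<and> card H \<in> {24, 48} \<or> g [^] (4::nat) \<in> Z \<and> card H = 48 \<or>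
    g [^] (5::nat) \<in> Z \<and> card H = 120 \<or> g [^] (3::nat) \<in> Z \<and> (p mod 10 = 1 \<or> p mod 10 = 9)"
proof -
  note carr = subgroup.mem_carrier[OF H(1)]
  interpret pc: paired_centralizers G H Z
  proof (intro paired_centralizers.intro paired_centralizers_axioms.intro)
    show "group G" by (rule group_G)
    show "finite H" using finite_G subgroup.subset[OF H(1)] finite_subset by blast
    show "z \<otimes> x = x \<otimes> z" if "z \<in> Z" "x \<in> H" for z x using Z_central that carr by blast
    show "y \<otimes> z = z \<otimes> y" if "x \<in> H" "x \<notin> Z" "y \<in> H" "z \<in> H" "x \<otimes> y = y \<otimes> x" "x \<otimes> z = z \<otimes> x" for x y z
      using centralizer_abelian[OF carr[OF that(1)] that(2) carr[OF that(3)] carr[OF that(4)] that(5,6)] .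
    show "y \<otimes> x \<otimes> inv y = x \<or> y \<otimes> x \<otimes> inv y = inv x"
      if "x \<in> H" "x \<notin> Z" "y \<in> H" "y \<otimes> x \<otimes> inv y \<otimes> x = x \<otimes> (y \<otimes> x \<otimes> inv y)" for x y
      using that carr
      by (intro commute_same_trace[OF carr[OF that(1)] that(2) np[OF that(1)]]) (simp_all add: tr_conj)
  qed (fact H subgroup_Z card_Z)+
  have pow: "x [^] n \<in> Z" if "x \<in> H" "card (pc.cent x) = 2 * n" for x n
  proof -
    interpret C: group "G\<lparr>carrier := pc.cent x\<rparr>"
      using subgroup.subgroup_is_group[OF pc.subgroup_cent[OF that(1)]] is_group by blast
    have "x \<in> pc.cent x" using that(1) by (simp add: pc.cent_def)
    then have "x [^]\<^bsub>G\<lparr>carrier := pc.cent x\<rparr>\<^esub> order (G\<lparr>carrier := pc.cent x\<rparr>) = \<one>\<^bsub>G\<lparr>carrier := pc.cent x\<rparr>\<^esub>"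
      using pc.finite_H by (intro C.pow_order_eq_1) (simp_all add: pc.cent_def)
    then have "x [^] (2 * n) = \<one>"
      using that(2) by (simp add: order_def nat_pow_consistent[symmetric])
    with even_pow_one_in_Z[OF carr[OF that(1)]] show ?thesis .
  qed
  \<comment> \<open>Order 4 would put the square of \<open>g\<close> into \<open>Z\<close>.\<close>
  have "card (pc.cent g) > 4"
  proof -
    obtain n where n: "card (pc.cent g) = 2 * n" "n \<ge> 2" using pc.card_cent[OF g(1,2)] .
    have "n \<noteq> 2" using pow[OF g(1) n(1)] g carr[OF g(1)] by (auto simp: numeral_2_eq_2)
    with n show ?thesis by simp
  qed
  moreover have "pc.conj_stab g \<noteq> H"
    using exc carr unfolding pc.conj_stab_eq[OF g(1,2)] inverting_def by blast
  ultimately consider "card (pc.cent g) = 6" "card H \<in> {24, 48}" | "card (pc.cent g) = 8" "card H = 48" |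
    "card (pc.cent g) = 10" "card H = 120" | "card (pc.cent g) = 6" "\<exists>y\<in>H - Z. card (pc.cent y) = 10"
    using pc.exceptional_orders[OF g(1,2)] by blast
  then show ?thesis
  proof cases
    case 4
    then obtain y where y: "y \<in> H" "y \<notin> Z" "card (pc.cent y) = 10" by blast
    then have "y [^] (5::nat) \<in> Z" using pow[of y 5] by simp
    then have "y \<otimes> y \<otimes> y \<otimes> y \<otimes> y \<in> Z" using carr[OF y(1)] by (simp add: eval_nat_numeral)
    with pow_five_in_Z[OF carr[OF y(1)] y(2)] pow[of g 3] 4 g show ?thesis by simp
  qed (use pow[of g 3] pow[of g 4] pow[of g 5] g in auto)
qed

text \<open>\<open>minimal\<close> and \<open>gen\<close> express generation modulo \<open>Z\<close>
  by containment in subgroups, which keeps the quotient group out of the argument.\<close>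

theorem no_common_element:
  fixes t :: "nat \<Rightarrow> int \<times> int \<times> int \<times> int" and M :: "nat \<Rightarrow> (int \<times> int \<times> int \<times> int) set" and m :: nat
  assumes m: "m \<ge> 3"
    and M: "\<And>i. i < m \<Longrightarrow> subgroup (M i) G" and ZM: "\<And>i. i < m \<Longrightarrow> Z \<subseteq> M i"
    and proper: "\<And>i. i < m \<Longrightarrow> M i \<noteq> carrier G"
    and gM: "\<And>i. i < m \<Longrightarrow> g \<in> M i"
    and tM: "\<And>i j. i < m \<Longrightarrow> j < m \<Longrightarrow> i \<noteq> j \<Longrightarrow> t j \<in> M i"
    and minimal: "\<And>i K. i < m \<Longrightarrow> subgroup K G \<Longrightarrow> Z \<subseteq> K \<Longrightarrow> g \<in> K \<Longrightarrow>
      (\<And>j. j < m \<Longrightarrow> j \<noteq> i \<Longrightarrow> t j \<in> K) \<Longrightarrow> M i \<subseteq> K"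
    and gen: "\<And>K. subgroup K G \<Longrightarrow> Z \<subseteq> K \<Longrightarrow> (\<And>j. j < m \<Longrightarrow> t j \<in> K) \<Longrightarrow> K = carrier G"
    and g: "g \<notin> Z" "g \<otimes> g \<notin> Z"
    and g3: "\<not> (g [^] (3::nat) \<in> Z \<and> (p mod 10 = 1 \<or> p mod 10 = 9))"
  shows False
proof -
  \<comment> \<open>Each \<open>t j\<close> lies in \<open>M i\<close> or in \<open>M k\<close>, as
    \<open>j\<close> cannot equal both indices.\<close>
  have two: "K = carrier G" if "i < m" "k < m" "i \<noteq> k" "subgroup K G" "M i \<subseteq> K" "M k \<subseteq> K" for i k K
  proof (rule gen)
    show "subgroup K G" by fact
    show "Z \<subseteq> K" using ZM that by blast
    show "t j \<in> K" if "j < m" for j using that tM \<open>i < m\<close> \<open>k < m\<close> \<open>i \<noteq> k\<close> \<open>M i \<subseteq> K\<close> \<open>M k \<subseteq> K\<close>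
      by (cases "j = i") blast+
  qed
  have gc: "g \<in> carrier G" using gM[of 0] M[of 0] m subgroup.mem_carrier[of "M 0" G g] by simp
  have tc: "t j \<in> carrier G" if "j < m" for j
  proof -
    have "(if j = 0 then 1 else 0) < m" "(if j = 0 then 1 else 0) \<noteq> j" using m by auto
    then show ?thesis using tM[OF _ that] M subgroup.mem_carrier[of "M (if j = 0 then 1 else 0)" G] by blast
  qed
  note inv_sub = subgroup_inverting[OF gc]
  note Z_inv = Z_subset_inverting[OF gc]
  have g_inv: "g \<in> inverting g" using gc commuting_in_inverting by blast
  have inv_proper: "inverting g \<noteq> carrier G" using inverting_proper[OF gc g(1)] .
  have gnp: "\<not> parabolic g"
  proof
    assume par: "parabolic g"
    obtain y where y: "y \<in> carrier G" "g \<in> borel_at y" using parabolic_fixes_line[OF par] .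
    have "M i \<subseteq> borel_at y" if "i < m" for i
      using parabolic_subgroup_borel[OF M ZM proper gM par y] that by blast
    then have "borel_at y = carrier G" using two[of 0 1] m subgroup_borel_at[OF y(1)] by simp
    with borel_at_proper y show False by blast
  qed
  have cases: "(\<exists>y\<in>carrier G. M i \<subseteq> borel_at y) \<or> M i \<subseteq> inverting g" if i: "i < m" for i
  proof (rule ccontr)
    assume contra: "\<not> ?thesis"
    have np: "\<not> parabolic u" if "u \<in> M i" for u
    proof
      assume par: "parabolic u"
      obtain y where y: "y \<in> carrier G" "u \<in> borel_at y" using parabolic_fixes_line[OF par] .
      from parabolic_subgroup_borel[OF M[OF i] ZM[OF i] proper[OF i] that par y] y contra show False by blast
    qed
    \<comment> \<open>By minimality of \<open>M i\<close> a single generator lies outside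
      \<open>inverting g\<close>; together with \<open>g\<close> it already generates a group of
      exceptional order.\<close>
    obtain j where j: "j < m" "j \<noteq> i" "t j \<notin> inverting g"
      using minimal[OF i inv_sub Z_inv g_inv] contra by blast
    define E where "E = generate G (insert g (insert (t j) Z))"
    have gens: "insert g (insert (t j) Z) \<subseteq> carrier G" using gc tc j Z_carrier by blast
    have E: "subgroup E G" unfolding E_def by (rule generate_is_subgroup[OF gens])
    have gE: "g \<in> E" and tE: "t j \<in> E" and ZE: "Z \<subseteq> E" by (auto simp: E_def intro: generate.incl)
    have EM: "E \<subseteq> M k" if "k < m" "k \<noteq> j" for k
      unfolding E_def using that gM tM j ZM M by (intro generate_subgroup_incl) auto
    \<comment> \<open>A parabolic element of \<open>M k\<close> would put \<open>g\<close> and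
      \<open>t j\<close> into one Borel subgroup. Both also lie in \<open>M i\<close>, which has no
      parabolic elements, so they would commute.\<close>
    have npM: "\<not> parabolic u" if k: "k < m" "k \<noteq> j" "u \<in> M k" for k u
    proof
      assume par: "parabolic u"
      obtain y where y: "y \<in> carrier G" "u \<in> borel_at y" using parabolic_fixes_line[OF par] .
      have "M k \<subseteq> borel_at y" 
        using parabolic_subgroup_borel[OF M[OF k(1)] ZM[OF k(1)] proper[OF k(1)] k(3) par y] .
      then have "g \<in> borel_at y" "t j \<in> borel_at y" using EM[OF k(1,2)] gE tE by blast+
      then have "t j \<otimes> g = g \<otimes> t j"
        using borel_at_nonparabolic_commute[OF M[OF i] np y(1), of "t j" g] EM[OF i] gE tE j by blast
      then show False using j(3) commuting_in_inverting gc tc j(1) by blast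
    qed
    have npE: "\<not> parabolic u" if "u \<in> E" for u using np EM[OF i] j that by blast
    have g1: "g [^] (1::nat) \<notin> Z" and g2: "g [^] (2::nat) \<notin> Z"
      using g gc by (simp_all add: numeral_2_eq_2)
    have e: "4 = 3 + (1::nat)" "5 = 4 + (1::nat)" "5 = 3 + (2::nat)" by simp_all
    \<comment> \<open>No two of the third, fourth and fifth powers of \<open>g\<close> are both
      central, since \<open>g\<close> and its square are not; so \<open>E\<close> and
      \<open>M k\<close> fall under the same exponent.\<close>
    have "card (M k) \<le> 2 * card E" if k: "k < m" "k \<noteq> j" for k
    proof -
      have "\<not> M k \<subseteq> inverting g" "\<not> E \<subseteq> inverting g" using j(3) tE EM[OF k] by blast+
      note * = exceptional_cases[OF M[OF k(1)] ZM[OF k(1)] npM[OF k] gM[OF k(1)] g this(1)]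
        exceptional_cases[OF E ZE npE gE g this(2)]
      have "\<not> (g [^] (3::nat) \<in> Z \<and> g [^] (4::nat) \<in> Z)" "\<not> (g [^] (4::nat) \<in> Z \<and> g [^] (5::nat) \<in> Z)"
        "\<not> (g [^] (3::nat) \<in> Z \<and> g [^] (5::nat) \<in> Z)"
        using pow_Z[OF gc _ _ e(1)] pow_Z[OF gc _ _ e(2)] pow_Z[OF gc _ _ e(3)] g1 g2 by blast+
      with * g3 have "card (M k) \<in> {24, 48} \<and> card E \<in> {24, 48} \<or>
        card (M k) = 48 \<and> card E = 48 \<or> card (M k) = 120 \<and> card E = 120"
        by blast
      then show ?thesis by auto
    qed
    then have norm: "y \<otimes> x \<otimes> inv y \<in> E" if "k < m" "k \<noteq> j" "y \<in> M k" "x \<in> E" for k y x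
      using index_two_normalizes[OF E M[OF that(1)] EM[OF that(1,2)] _ _ that(3,4)] that(1,2)
        finite_subset[OF subgroup.subset[OF M[OF that(1)]] finite_G] by blast
    let ?N = "{y \<in> carrier G. \<forall>x\<in>E. y \<otimes> x \<otimes> inv y \<in> E \<and> inv y \<otimes> x \<otimes> y \<in> E}"
    have MN: "M k \<subseteq> ?N" if k: "k < m" "k \<noteq> j" for k
    proof
      fix y assume y: "y \<in> M k"
      then have yc: "y \<in> carrier G" and iy: "inv y \<in> M k"
        using subgroup.mem_carrier[OF M[OF k(1)]] subgroup.m_inv_closed[OF M[OF k(1)]] by auto
      from norm[OF k y] norm[OF k iy] yc show "y \<in> ?N" by simp
    qed
    \<comment> \<open>With at least three indices two remain besides \<open>j\<close>, and
      \<open>two\<close> applies to the normalizer of \<open>E\<close>.\<close>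
    obtain k l where "k < m" "l < m" "k \<noteq> j" "l \<noteq> j" "k \<noteq> l"
    proof -
      consider "j = 0" | "j = 1" | "j > 1" by linarith
      then show thesis using that[of 1 2] that[of 0 2] that[of 0 1] m by cases auto
    qed
    then have "?N = carrier G"
      using two[of k l ?N] MN subgroup_conj_stabalizing[OF subgroup.subset[OF E]] by blast
    then have "E \<lhd> G" using E unfolding normal_inv_iff by blast
    with normal_contains_parabolic gE g(1) npE show False by blast
  qed
  have distinct: "inv x \<otimes> y \<notin> borel"
    if "i < m" "k < m" "i \<noteq> k" "x \<in> carrier G" "y \<in> carrier G" "M i \<subseteq> borel_at x" "M k \<subseteq> borel_at y" for i k x y
  proof
    assume "inv x \<otimes> y \<in> borel"
    then have "borel_at x = borel_at y" using borel_at_eq that by blast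
    then have "borel_at x = carrier G" using two[of i k "borel_at x"] subgroup_borel_at that by simp
    then show False using borel_at_proper that by blast
  qed
  \<comment> \<open>Otherwise three of the subgroups fix pairwise different points, and
    \<open>g\<close>, fixing all three, is central.\<close>
  have "\<exists>c<3. M c \<subseteq> inverting g"
  proof (rule ccontr)
    assume "\<not> ?thesis"
    then have ex: "\<exists>y\<in>carrier G. M i \<subseteq> borel_at y" if "i < 3" for i using cases[of i] that m by auto
    obtain x where x: "x \<in> carrier G" "M 0 \<subseteq> borel_at x" using ex[of 0] by auto
    obtain y where y: "y \<in> carrier G" "M 1 \<subseteq> borel_at y" using ex[of 1] by auto
    obtain z where z: "z \<in> carrier G" "M 2 \<subseteq> borel_at z" using ex[of 2] by auto
    have "inv x \<otimes> y \<notin> borel" "inv x \<otimes> z \<notin> borel" "inv y \<otimes> z \<notin> borel"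
      using distinct[of 0 1 x y] distinct[of 0 2 x z] distinct[of 1 2 y z] x y z m by simp_all
    moreover have "g \<in> borel_at x" "g \<in> borel_at y" "g \<in> borel_at z"
      using gM[of 0] gM[of 1] gM[of 2] x y z m by auto
    ultimately have "g \<in> Z" using three_borels_central x(1) y(1) z(1) by blast
    with g show False by blast
  qed
  then obtain c where c: "c < 3" "M c \<subseteq> inverting g" by blast
  then have cm: "c < m" using m by simp
  obtain a b where ab: "a < m" "b < m" "a \<noteq> b" "a \<noteq> c" "b \<noteq> c"
  proof -
    from c(1) consider "c = 0" | "c = 1" | "c = 2" by linarith
    then show thesis using that[of 1 2] that[of 0 2] that[of 0 1] m by cases auto
  qed
  have B: "\<exists>y\<in>carrier G. M i \<subseteq> borel_at y" if "i < m" "i \<noteq> c" for i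
    using cases[OF that(1)] two[of i c "inverting g"] that cm c inv_sub inv_proper by blast
  obtain x where x: "x \<in> carrier G" "M a \<subseteq> borel_at x" using B ab by blast
  obtain y where y: "y \<in> carrier G" "M b \<subseteq> borel_at y" using B ab by blast
  have gB: "g \<in> borel_at x" "g \<in> borel_at y" using gM x y ab by blast+
  \<comment> \<open>\<open>t c\<close> fixes the same two points as \<open>g\<close>. Every other
    \<open>t j\<close> lies in \<open>M c\<close> and in one of the two Borel subgroups, where
    normalizing the centralizer of \<open>g\<close> means commuting with \<open>g\<close>.\<close>
  have "t j \<otimes> g = g \<otimes> t j" if j: "j < m" for j
  proof (cases "j = c")
    case True
    then have "t j \<in> borel_at x" "t j \<in> borel_at y" using tM ab cm x y by blast+
    with borel_at_commute[OF x(1) y(1) distinct[OF ab(1-3) x(1) y(1) x(2) y(2)]] gB show ?thesis by blast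
  next
    case False
    then have tj: "t j \<in> inverting g" using tM cm j c by blast
    have "t j \<in> borel_at x \<or> t j \<in> borel_at y" using tM j ab x y by (cases "j = a") blast+
    with inverting_borel_at_commute[OF x(1) gB(1) g(1) gnp _ tj]
      inverting_borel_at_commute[OF y(1) gB(2) g(1) gnp _ tj] show ?thesis by blast
  qed
  then have "t j \<in> inverting g" if "j < m" for j using that commuting_in_inverting gc tc by blast
  then show False using gen[OF inv_sub Z_inv] inv_proper by blast
qed

section \<open>The quotient group\<close>

sublocale Zn: normal Z G by (rule normal_Z)

lemma PSL2_eq: "PSL2 p = G Mod Z"
  by (simp add: PSL2_def G_def Z_def)

lemma group_PSL: "group (G Mod Z)"
  by (rule Zn.factorgroup_is_group)

lemma coset_carrier: "x \<in> carrier G \<Longrightarrow> Z #> x \<in> carrier (G Mod Z)"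
  by (auto simp: FactGroup_def RCOSETS_def)

lemma coset_cases:
  assumes "C \<in> carrier (G Mod Z)"
  obtains x where "x \<in> carrier G" "C = Z #> x"
  using assms by (auto simp: FactGroup_def RCOSETS_def)

lemma one_PSL: "\<one>\<^bsub>G Mod Z\<^esub> = Z"
  by (simp add: FactGroup_def)

lemma coset_one_iff: "x \<in> carrier G \<Longrightarrow> Z #> x = \<one>\<^bsub>G Mod Z\<^esub> \<longleftrightarrow> x \<in> Z"
  unfolding one_PSL using coset_join1[OF _ _ subgroup_Z, of x] coset_join2[OF _ subgroup_Z, of x] by blast

lemma coset_hom: "group_hom G (G Mod Z) (\<lambda>x. Z #> x)"
  using Zn.r_coset_hom_Mod group_PSL is_group by (simp add: group_hom_def group_hom_axioms_def)

lemma coset_pow: "x \<in> carrier G \<Longrightarrow> (Z #> x) [^]\<^bsub>G Mod Z\<^esub> n = Z #> (x [^] n)" for n :: nat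
  using group_hom.hom_nat_pow[OF coset_hom] by simp

lemma subgroup_coset_image: "subgroup K G \<Longrightarrow> subgroup ((\<lambda>x. Z #> x) ` K) (G Mod Z)"
  using group_hom.subgroup_img_is_subgroup[OF coset_hom] .

lemma coset_in_image_iff:
  assumes K: "subgroup K G" "Z \<subseteq> K" and x: "x \<in> carrier G"
  shows "Z #> x \<in> (\<lambda>x. Z #> x) ` K \<longleftrightarrow> x \<in> K"
proof
  assume "Z #> x \<in> (\<lambda>x. Z #> x) ` K"
  then obtain k where k: "k \<in> K" "Z #> x = Z #> k" by blast
  have "x \<in> Z #> k" using rcos_self[OF x subgroup_Z] k(2) by simp
  then obtain z where "z \<in> Z" "x = z \<otimes> k" by (auto simp: r_coset_def)
  then show "x \<in> K" using subgroup.m_closed[OF K(1)] K(2) k(1) by blast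
qed blast

text \<open>Transfers generation in the quotient to containment in a subgroup of SL(2,p) above
  \<open>Z\<close>, the form used in \<open>no_common_element\<close>.\<close>

lemma generate_image_incl:
  assumes K: "subgroup K G" "Z \<subseteq> K" and S: "S \<subseteq> (\<lambda>x. Z #> x) ` K"
    and x: "x \<in> carrier G" "Z #> x \<in> generate (G Mod Z) S"
  shows "x \<in> K"
  using group.generate_subgroup_incl[OF group_PSL S subgroup_coset_image[OF K(1)]] x
    coset_in_image_iff[OF K x(1)] by blast

lemma three_le_max_irr: "max_irr (G Mod Z) \<ge> 3"
proof -
  obtain x y z where xyz: "x \<in> carrier G" "y \<in> carrier G" "z \<in> carrier G" "tr x = 0" "tr y = 0" "tr z = 0"
    and gen: "\<And>H. subgroup H G \<Longrightarrow> x \<in> H \<Longrightarrow> y \<in> H \<Longrightarrow> z \<in> H \<Longrightarrow> H = carrier G"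
    by (rule three_trace_zero_generators) (rule that)
  let ?s = "[Z #> x, Z #> y, Z #> z]"
  have sub: "set ?s \<subseteq> carrier (G Mod Z)" using xyz coset_carrier by auto
  have "generating_seq (G Mod Z) ?s"
  proof -
    let ?A = "generate (G Mod Z) (set ?s)"
    have A: "subgroup ?A (G Mod Z)" by (rule group.generate_is_subgroup[OF group_PSL sub])
    \<comment> \<open>Elements of the quotient are cosets, so the union of a subgroup is its
      preimage in SL(2,p).\<close>
    have U: "\<Union>?A = {u \<in> carrier G. Z #> u \<in> ?A}" by (rule Zn.factgroup_subgroup_union_char[OF A])
    have "\<Union>?A = carrier G"
      by (rule gen[OF Zn.factgroup_subgroup_union_subgroup[OF A]])
        (use xyz in \<open>auto simp only: U intro!: generate.incl\<close>; simp)+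
    then have "carrier (G Mod Z) \<subseteq> ?A" using U by (auto elim!: coset_cases)
    then show ?thesis using sub subgroup.subset[OF A] by (auto simp: generating_seq_def)
  qed
  moreover have "\<not> generating_seq (G Mod Z) t" if "strict_subseq t ?s" for t
  proof
    assume gent: "generating_seq (G Mod Z) t"
    from strict_subseq_triple[OF that]
    obtain u v where uv: "u \<in> {x, y, z}" "v \<in> {x, y, z}" "set t \<subseteq> {Z #> u, Z #> v}" by blast
    then have "u \<in> carrier G" "tr u = 0" "v \<in> carrier G" "tr v = 0" using xyz by auto
    then obtain K where K: "subgroup K G" "Z \<subseteq> K" "u \<in> K" "v \<in> K" "K \<noteq> carrier G"
      by (rule trace_zero_pair_proper)
    have "carrier G \<subseteq> K"
    proof
      fix w assume w: "w \<in> carrier G"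
      then have "Z #> w \<in> generate (G Mod Z) (set t)"
        using gent coset_carrier by (simp add: generating_seq_def)
      then show "w \<in> K" using generate_image_incl[OF K(1,2) _ w] uv(3) K(3,4) by blast
    qed
    with K(5) subgroup.subset[OF K(1)] show False by blast
  qed
  ultimately have "irredundant_gen_seq (G Mod Z) ?s" by (auto simp: irredundant_gen_seq_def)
  moreover have "finite (carrier (G Mod Z))"
    using finite_G by (simp add: FactGroup_def RCOSETS_def)
  ultimately show ?thesis using length_le_max_irr by fastforce
qed

lemma witness_to_failure_order:
  assumes g: "witness_to_failure (G Mod Z) g"
  obtains x where "x \<in> carrier G" "g = Z #> x" "x \<notin> Z"
    "x \<otimes> x \<in> Z \<or> x [^] (3::nat) \<in> Z \<and> (p mod 10 = 1 \<or> p mod 10 = 9)"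
proof -
  let ?P = "G Mod Z"
  obtain s where gP: "g \<in> carrier ?P" and g1: "g \<noteq> \<one>\<^bsub>?P\<^esub>"
    and s: "irredundant_gen_seq ?P s" "length s = max_irr ?P"
    and fail: "\<And>i. i < length s \<Longrightarrow> \<not> generating_seq ?P (s[i := g])"
    using g unfolding witness_to_failure_def by blast
  obtain x where x: "x \<in> carrier G" "g = Z #> x" using gP by (rule coset_cases)
  have xZ: "x \<notin> Z" using g1 x coset_one_iff by blast
  have gen_s: "set s \<subseteq> carrier ?P" "generate ?P (set s) = carrier ?P"
    using s(1) by (auto simp: irredundant_gen_seq_def generating_seq_def)
  have "\<forall>j<length s. \<exists>y. y \<in> carrier G \<and> s ! j = Z #> y"
  proof (intro allI impI)
    fix j assume "j < length s"
    then have "s ! j \<in> carrier ?P" using gen_s(1) nth_mem by blast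
    then show "\<exists>y. y \<in> carrier G \<and> s ! j = Z #> y" by (rule coset_cases) blast
  qed
  then obtain t where t: "\<And>j. j < length s \<Longrightarrow> t j \<in> carrier G" "\<And>j. j < length s \<Longrightarrow> s ! j = Z #> t j"
    by metis
  define A where "A i = generate ?P (set (s[i := g]))" for i
  have subA: "set (s[i := g]) \<subseteq> carrier ?P" for i
    using gen_s(1) gP set_update_subset_insert[of s i g] by blast
  have A: "subgroup (A i) ?P" for i unfolding A_def by (rule group.generate_is_subgroup[OF group_PSL subA])
  \<comment> \<open>These preimages are the subgroups \<open>M i\<close> of
    \<open>no_common_element\<close>.\<close>
  have U: "\<Union>(A i) = {u \<in> carrier G. Z #> u \<in> A i}" for i by (rule Zn.factgroup_subgroup_union_char[OF A])
  have set_upd: "set (s[i := g]) \<subseteq> insert g {s ! j | j. j < length s \<and> j \<noteq> i}" for i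
  proof
    fix C assume "C \<in> set (s[i := g])"
    then obtain k where k: "k < length s" "C = s[i := g] ! k" by (metis in_set_conv_nth length_list_update)
    then show "C \<in> insert g {s ! j | j. j < length s \<and> j \<noteq> i}" by (cases "k = i") auto
  qed
  have "x \<otimes> x \<in> Z \<or> x [^] (3::nat) \<in> Z \<and> (p mod 10 = 1 \<or> p mod 10 = 9)"
  proof (rule ccontr)
    assume "\<not> ?thesis"
    then have x2: "x \<otimes> x \<notin> Z" and x3: "\<not> (x [^] (3::nat) \<in> Z \<and> (p mod 10 = 1 \<or> p mod 10 = 9))" by auto
    show False
    proof (rule no_common_element[of "length s" "\<lambda>i. \<Union>(A i)" x t])
      show "3 \<le> length s" using s(2) three_le_max_irr by simp
      show "subgroup (\<Union>(A i)) G" for i by (rule Zn.factgroup_subgroup_union_subgroup[OF A])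
      show "Z \<subseteq> \<Union>(A i)" for i
        using subgroup.one_closed[OF A[of i]] by (auto simp: one_PSL)
      show "\<Union>(A i) \<noteq> carrier G" if "i < length s" for i
      proof
        assume "\<Union>(A i) = carrier G"
        then have "carrier ?P \<subseteq> A i" using U[of i] by (auto elim!: coset_cases)
        then have "generating_seq ?P (s[i := g])"
          using subA subgroup.subset[OF A[of i]] by (auto simp: generating_seq_def A_def)
        with fail that show False by blast
      qed
      show "x \<in> \<Union>(A i)" if "i < length s" for i
      proof -
        have "g \<in> A i" unfolding A_def using that by (intro generate.incl) (rule set_update_memI)
        then show ?thesis unfolding U using x by simp
      qed
      show "t j \<in> \<Union>(A i)" if "i < length s" "j < length s" "i \<noteq> j" for i j
      proof -
        have "s ! j \<in> A i" unfolding A_def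
          using that by (intro generate.incl) (metis length_list_update nth_list_update_neq nth_mem)
        then show ?thesis unfolding U using t that by simp
      qed
      show "\<Union>(A i) \<subseteq> K" if "i < length s" "subgroup K G" "Z \<subseteq> K" "x \<in> K"
        "\<And>j. j < length s \<Longrightarrow> j \<noteq> i \<Longrightarrow> t j \<in> K" for i K
      proof
        fix u assume "u \<in> \<Union>(A i)"
        then have "u \<in> carrier G" "Z #> u \<in> A i" unfolding U by auto
        then have u: "u \<in> carrier G" "Z #> u \<in> generate ?P (set (s[i := g]))" unfolding A_def .
        have "set (s[i := g]) \<subseteq> (\<lambda>x. Z #> x) ` K" using set_upd[of i] x(2) t(2) that(4,5) by blast
        from generate_image_incl[OF that(2,3) this u] show "u \<in> K" .
      qed
      show "K = carrier G" if "subgroup K G" "Z \<subseteq> K" "\<And>j. j < length s \<Longrightarrow> t j \<in> K" for K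
      proof
        show "K \<subseteq> carrier G" using subgroup.subset[OF that(1)] .
        show "carrier G \<subseteq> K"
        proof
          fix u assume u: "u \<in> carrier G"
          have "set s \<subseteq> (\<lambda>x. Z #> x) ` K" using t(2) that(3) by (fastforce simp: in_set_conv_nth)
          from generate_image_incl[OF that(1,2) this u] show "u \<in> K"
            unfolding gen_s(2) using coset_carrier[OF u] by blast
        qed
      qed
    qed (use xZ x2 x3 in auto)
  qed
  with x xZ that show thesis by blast
qed

lemma coset_ord_dvd:
  assumes "x \<in> carrier G" "x [^] n \<in> Z"
  shows "group.ord (G Mod Z) (Z #> x) dvd n"
  unfolding group.pow_eq_id[OF group_PSL coset_carrier[OF assms(1)], symmetric] coset_pow[OF assms(1)]
  using assms coset_one_iff by simp

lemma coset_ord_prime: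
  assumes x: "x \<in> carrier G" "x \<notin> Z" and n: "x [^] n \<in> Z" "Factorial_Ring.prime n"
  shows "group.ord (G Mod Z) (Z #> x) = n"
proof -
  have "group.ord (G Mod Z) (Z #> x) \<noteq> 1"
    using x group.ord_eq_1[OF group_PSL coset_carrier[OF x(1)]] coset_one_iff by blast
  with coset_ord_dvd[OF x(1) n(1)] n(2) show ?thesis by (metis prime_nat_iff)
qed

end

theorem theorem2:
  fixes p :: int and g :: "(int \<times> int \<times> int \<times> int) set"
  assumes "Factorial_Ring.prime p" and "p > 5" and "witness_to_failure (PSL2 p) g"
  shows "group.ord (PSL2 p) g \<in> {2, 3} \<and>
         (p mod 10 \<noteq> 1 \<and> p mod 10 \<noteq> 9 \<longrightarrow> group.ord (PSL2 p) g = 2)"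
proof -
  interpret sl2 p "SL2 p" using assms by unfold_locales auto
  obtain x where x: "x \<in> carrier (SL2 p)" "g = Z #>\<^bsub>SL2 p\<^esub> x" "x \<notin> Z"
    and *: "x \<otimes>\<^bsub>SL2 p\<^esub> x \<in> Z \<or> x [^]\<^bsub>SL2 p\<^esub> (3::nat) \<in> Z \<and> (p mod 10 = 1 \<or> p mod 10 = 9)"
    using witness_to_failure_order[of g] assms(3) unfolding PSL2_eq by blast
  have "group.ord (PSL2 p) g = 2" if "x \<otimes>\<^bsub>SL2 p\<^esub> x \<in> Z"
  proof -
    have "x [^]\<^bsub>SL2 p\<^esub> (2::nat) \<in> Z" using that x(1) by (simp add: numeral_2_eq_2)
    then show ?thesis unfolding PSL2_eq x(2) using x by (intro coset_ord_prime) simp_all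
  qed
  moreover have "group.ord (PSL2 p) g = 3" if "x [^]\<^bsub>SL2 p\<^esub> (3::nat) \<in> Z"
    unfolding PSL2_eq x(2) using that x by (intro coset_ord_prime) simp_all
  ultimately show ?thesis using * by auto
qed

end
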